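(* Let $k\geq 1$ and let $G$ be a finitely generated group of invertible $k\times k$ matrices with rational entries that is a subgroup of a compact group of $k\times k$ matrices. Then $G$ is PA'-recognizable. Hence $\mathbb{Z}\times G$ admits a strongly aperiodic subshift of finite type.
   Context: PA'-recognizability: let $\mathcal F=\{f_i:B_i\to B_i',\ i=1,\dots,m\}$ be a finite set of piecewise affine rational homeomorphisms, where each $B_i$ and $B_i'$ is a finite union of bounded rational polytopes of $\mathbb{R}^n$ (for a common $n$); that is, each $f_i$ is a homeomorphism and $B_i$ is a finite union of bounded rational polytopes on each of which $f_i$ is of the form $x\mapsto Mx+b$ with $M,b$ having rational entries. Let $S_{\mathcal F}$ be the closure of the set of all $f_i$ and $f_i^{-1}$ under composition of partial functions (elements of $S_{\mathcal F}$ are partial maps, defined wherever the composition makes sense, possibly with empty domain). Let $T_{\mathcal F}$ be the common domain (the intersection of the domains) of all functions in $S_{\mathcal F}$. The group generated by $\mathcal F$ is $G_{\mathcal F}=\{f_{|T_{\mathcal F}}: f\in S_{\mathcal F}\}$, a group of bijections of $T_{\mathcal F}$ under composition. A finitely generated group $G$ is PA'-recognizable if there is such a finite set $\mathcal F$ with: (A) $G$ is isomorphic to $G_{\mathcal F}$; (B) for every $t\in T_{\mathcal F}$ and $g\in G_{\mathcal F}$, if $g(f(t))=f(t)$ for all $f\in G_{\mathcal F}$, then $g$ is the identity. Subshifts: let $H$ be a finitely generated group and $A$ a finite alphabet. $H$ acts on $A^H$ by $(gx)_h=x_{g^{-1}h}$. A subshift of finite type (SFT) over $H$ is a set $X\subseteq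 A^H$ for which there is a finite set $L$ of maps $w:D_w\to A$ ($D_w\subseteq H$ finite) such that $X$ is the set of all $x\in A^H$ such that for every $g\in H$ and $w\in L$ the restriction of $gx$ to $D_w$ differs from $w$. Let $Stab(x)=\{g\in H:gx=x\}$. A subshift $X$ is strongly aperiodic if it is nonempty and $Stab(x)$ is finite for every $x\in X$. "$H$ admits" such an SFT means one exists over some finite alphabet.
   Formalization: The second conclusion (a strongly aperiodic SFT on Z×G) is stated only for infinite G; for finite G it is false, since e.g. for trivial G every nonempty SFT over Z contains a periodic point with infinite stabilizer. *)

theory Defs
  imports "HOL-Analysis.Analysis" "HOL-Algebra.Elementary_Groups"
begin

section \<open>Finitely generated groups and matrix groups\<close>

definition fin_gen :: "('a, 'm) monoid_scheme \<Rightarrow> bool" where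
  "fin_gen G \<longleftrightarrow> (\<exists>S. finite S \<and> S \<subseteq> carrier G \<and> generate G S = carrier G)"

definition GL :: "(real^'k^'k) monoid" where
  "GL = \<lparr>carrier = {A. invertible A}, mult = (**), one = mat 1\<rparr>"


section \<open>Piecewise affine rational homeomorphisms\<close>

text \<open>
  The dimension \<open>n\<close> has to be quantified existentially, so \<open>\<real>\<^sup>n\<close> is the space
  \<^const>\<open>Euclidean_space\<close> \<open>n\<close> of sequences vanishing from index \<open>n\<close> on. Its underlying type is
  \<open>nat \<Rightarrow> real\<close>, whose generic metric is bounded; boundedness is therefore spelled out
  coordinatewise.
\<close>

definition rational_polytope :: "nat \<Rightarrow> (nat \<Rightarrow> real) set \<Rightarrow> bool" where
  "rational_polytope n P \<longleftrightarrow>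
     (\<exists>C :: ((nat \<Rightarrow> rat) \<times> rat) set. finite C \<and>
        P = {x \<in> topspace (Euclidean_space n).
               \<forall>(a, c) \<in> C. (\<Sum>i<n. of_rat (a i) * x i) \<le> of_rat c})"

definition bounded_rational_polytope :: "nat \<Rightarrow> (nat \<Rightarrow> real) set \<Rightarrow> bool" where
  "bounded_rational_polytope n P \<longleftrightarrow>
     rational_polytope n P \<and> (\<exists>r. \<forall>x\<in>P. \<forall>i<n. \<bar>x i\<bar> \<le> r)"

definition rational_affine ::
  "nat \<Rightarrow> (nat \<Rightarrow> nat \<Rightarrow> rat) \<Rightarrow> (nat \<Rightarrow> rat) \<Rightarrow> (nat \<Rightarrow> real) \<Rightarrow> (nat \<Rightarrow> real)" where
  "rational_affine n M b x =
     (\<lambda>i. if i < n then (\<Sum>j<n. of_rat (M i j) * x j) + of_rat (b i) else 0)"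

definition pa_rational_homeo :: "nat \<Rightarrow> ((nat \<Rightarrow> real) \<rightharpoonup> (nat \<Rightarrow> real)) \<Rightarrow> bool" where
  "pa_rational_homeo n f \<longleftrightarrow>
     homeomorphic_map (subtopology (Euclidean_space n) (dom f))
                      (subtopology (Euclidean_space n) (ran f)) (the \<circ> f) \<and>
     (\<exists>\<P>. finite \<P> \<and> (\<forall>P\<in>\<P>. bounded_rational_polytope n P) \<and> dom f = \<Union>\<P> \<and>
          (\<forall>P\<in>\<P>. \<exists>M b. \<forall>x\<in>P. f x = Some (rational_affine n M b x))) \<and>
     (\<exists>\<Q>. finite \<Q> \<and> (\<forall>Q\<in>\<Q>. bounded_rational_polytope n Q) \<and> ran f = \<Union>\<Q>)"


section \<open>The group generated by a set of partial injections\<close>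

definition partial_inv :: "('a \<rightharpoonup> 'b) \<Rightarrow> ('b \<rightharpoonup> 'a)" where
  "partial_inv f y = (if y \<in> ran f then Some (THE x. f x = Some y) else None)"

inductive_set pmaps :: "('a \<rightharpoonup> 'a) set \<Rightarrow> ('a \<rightharpoonup> 'a) set" for F where
  base: "f \<in> F \<Longrightarrow> f \<in> pmaps F"
| inverse: "f \<in> F \<Longrightarrow> partial_inv f \<in> pmaps F"
| comp: "f \<in> pmaps F \<Longrightarrow> g \<in> pmaps F \<Longrightarrow> f \<circ>\<^sub>m g \<in> pmaps F"

definition common_dom :: "('a \<rightharpoonup> 'a) set \<Rightarrow> 'a set" where
  "common_dom F = (\<Inter>f\<in>pmaps F. dom f)"

text \<open>For \<open>F = {}\<close> the carrier below is empty, so it is not isomorphic to any group.\<close>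

definition pmap_group :: "('a \<rightharpoonup> 'a) set \<Rightarrow> ('a \<rightharpoonup> 'a) monoid" where
  "pmap_group F =
     \<lparr>carrier = {f |` common_dom F | f. f \<in> pmaps F},
      mult = (\<circ>\<^sub>m),
      one = Some |` common_dom F\<rparr>"

definition PA'_recognizable :: "('g, 'm) monoid_scheme \<Rightarrow> bool" where
  "PA'_recognizable G \<longleftrightarrow>
     group G \<and> fin_gen G \<and>
     (\<exists>n F. finite F \<and> (\<forall>f\<in>F. pa_rational_homeo n f) \<and>
        G \<cong> pmap_group F \<and>
        (\<forall>t\<in>common_dom F. \<forall>g\<in>carrier (pmap_group F).
           (\<forall>f\<in>carrier (pmap_group F). (g \<circ>\<^sub>m f) t = f t) \<longrightarrow> g = \<one>\<^bsub>pmap_group F\<^esub>))"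


section \<open>Subshifts of finite type\<close>

text \<open>
  Configurations in \<open>A\<^sup>H\<close> are the elements of \<open>carrier H \<rightarrow>\<^sub>E A\<close>.
\<close>

definition shift :: "('g, 'm) monoid_scheme \<Rightarrow> 'g \<Rightarrow> ('g \<Rightarrow> 'a) \<Rightarrow> ('g \<Rightarrow> 'a)" where
  "shift H g x = (\<lambda>h\<in>carrier H. x (inv\<^bsub>H\<^esub> g \<otimes>\<^bsub>H\<^esub> h))"

definition SFT :: "('g, 'm) monoid_scheme \<Rightarrow> 'a set \<Rightarrow> ('g \<Rightarrow> 'a) set \<Rightarrow> bool" where
  "SFT H A X \<longleftrightarrow>
     (\<exists>L. finite L \<and>
        (\<forall>w\<in>L. finite (dom w) \<and> dom w \<subseteq> carrier H \<and> ran w \<subseteq> A) \<and>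
        X = {x \<in> carrier H \<rightarrow>\<^sub>E A.
               \<forall>g\<in>carrier H. \<forall>w\<in>L. (Some \<circ> shift H g x) |` dom w \<noteq> w})"

definition Stab :: "('g, 'm) monoid_scheme \<Rightarrow> ('g \<Rightarrow> 'a) \<Rightarrow> 'g set" where
  "Stab H x = {g \<in> carrier H. shift H g x = x}"

definition strongly_aperiodic :: "('g, 'm) monoid_scheme \<Rightarrow> ('g \<Rightarrow> 'a) set \<Rightarrow> bool" where
  "strongly_aperiodic H X \<longleftrightarrow> X \<noteq> {} \<and> (\<forall>x\<in>X. finite (Stab H x))"

text \<open>Alphabets are taken to be finite sets of natural numbers, which covers every finite
  alphabet up to renaming.\<close>

definition admits_strongly_aperiodic_SFT :: "('g, 'm) monoid_scheme \<Rightarrow> bool" where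
  "admits_strongly_aperiodic_SFT H \<longleftrightarrow>
     (\<exists>(A :: nat set) X. finite A \<and> SFT H A X \<and> strongly_aperiodic H X)"

end

theory Submission
  imports Defs
begin

text \<open>
  The group \<open>G\<close> lies in a compact set \<open>K\<close> of invertible matrices, and left multiplication of \<open>G\<close> on
  invertible matrices is free. Both halves of the theorem rest on making this free action visible to
  finite, rational data. Invertibility is an open condition, so after scaling by a large \<open>N\<close> the
  compact set \<open>N \<sqdot> K\<close> is covered by finitely many unit cubes with integer corners that consist of
  invertible matrices only (\<open>compact_invertible_cubes\<close>). Identify \<open>k \<times> k\<close> matrices with points of
  \<open>\<real>\<^sup>n\<close>, \<open>n = k\<^sup>2\<close>, and let \<open>B\<close> be the union of the cubes.

  For PA'-recognizability, each generator \<open>s\<close> gives the map \<open>x \<mapsto> s x\<close> with domain \<open>B\<close>; it is linear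
  with rational coefficients. The common domain of all composites is a subset of \<open>B\<close>, on which \<open>G\<close>
  acts freely, and it is nonempty because it contains the orbit of \<open>N\<close> times the identity matrix,
  which stays inside \<open>N \<sqdot> K\<close>. Hence the group of restrictions is a faithful copy of \<open>G\<close>, and
  an element that fixes a single point of the common domain is the identity
  (\<open>generated_free_action\<close>, \<open>PA'_recognizable_G\<close>).

  For the subshift over \<open>\<int> \<times> G\<close>, a configuration is read as one bi-infinite sequence of integer
  matrices \<open>a z h\<close> for every \<open>h \<in> G\<close>. Along each line the matrices \<open>a z h\<close> are confined to one of
  the cubes, and a local rule with a bounded carry, in the style of Kari's tilings, forces
  the average of line \<open>h s\<inverse>\<close> to be \<open>s\<close> times the average of line \<open>h\<close>. So the line at \<open>g\<inverse>\<close> has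
  average \<open>g t\<close>, where the average \<open>t\<close> of the line at the identity, a limit point of the averages over its
  blocks, lies in a cube and is invertible.
  Such configurations exist: take differences of consecutive roundings of \<open>z N h\<inverse>\<close>; the carry is then
  a rounding defect, which takes finitely many values because \<open>s\<close> is rational. If \<open>(m, g)\<close> fixes a
  configuration, the lines at the identity and at \<open>g\<inverse>\<close> are translates of one another, so \<open>g t = t\<close>,
  and \<open>g\<close> is the identity.
  If moreover \<open>m \<noteq> 0\<close>, all lines have period \<open>m\<close>, their period sums are integer matrices from a bounded
  set, and \<open>g \<mapsto> g t\<close> would inject the infinite group \<open>G\<close> into a finite set. Hence
  stabilizers are trivial.
\<close>

section \<open>Real matrices\<close>

lemma invertible_if_right_inverse:
  fixes A :: "real^'k^'k"
  assumes "A ** B = mat 1" shows "invertible A"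
  using assms matrix_left_right_inverse by (auto simp: invertible_def)

lemma invertible_scaleR_iff:
  fixes A :: "real^'k^'k"
  assumes "c \<noteq> 0" shows "invertible (c *\<^sub>R A) \<longleftrightarrow> invertible A"
proof -
  have *: "invertible (d *\<^sub>R B)" if "d \<noteq> 0" "invertible B" for d and B :: "real^'k^'k"
    using that scalar_invertible by blast
  show ?thesis
    using *[OF assms, of A] *[of "inverse c" "c *\<^sub>R A"] assms by auto
qed

lemma matrix_inv_mult:
  fixes A :: "real^'k^'k"
  assumes "invertible A"
  shows "matrix_inv A ** A = mat 1" "A ** matrix_inv A = mat 1"
  using someI_ex[OF assms[unfolded invertible_def]] by (auto simp: matrix_inv_def)

lemma matrix_inv_eqI:
  fixes A :: "real^'k^'k"
  assumes "A ** B = mat 1"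
  shows "matrix_inv A = B"
  by (metis assms invertible_if_right_inverse matrix_inv_mult(1) matrix_mul_assoc matrix_mul_lid matrix_mul_rid)

lemma matrix_inv_one: "matrix_inv (mat 1 :: real^'k^'k) = mat 1"
  by (rule matrix_inv_eqI) simp

lemma bounded_linear_matrix_mult_left: "bounded_linear (\<lambda>B :: real^'p^'m. (A :: real^'m^'n) ** B)"
  unfolding linear_conv_bounded_linear[symmetric]
  by (rule linearI) (auto simp: matrix_add_ldistrib matrix_scalar_ac scalar_matrix_assoc)

lemmas matrix_mult_left_simps =
  linear_0[OF bounded_linear.linear[OF bounded_linear_matrix_mult_left]]
  linear_add[OF bounded_linear.linear[OF bounded_linear_matrix_mult_left]]
  linear_diff[OF bounded_linear.linear[OF bounded_linear_matrix_mult_left]]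
  linear_scale[OF bounded_linear.linear[OF bounded_linear_matrix_mult_left]]

lemma norm_matrix_le:
  fixes M :: "real^'m^'n"
  assumes "\<And>i j. \<bar>M $ i $ j\<bar> \<le> c"
  shows "norm M \<le> real CARD('n) * (real CARD('m) * c)"
proof -
  have "norm M \<le> (\<Sum>i\<in>UNIV. norm (M $ i))"
    by (simp add: norm_vec_def L2_set_le_sum)
  also have "\<dots> \<le> (\<Sum>i\<in>UNIV. \<Sum>j\<in>UNIV. \<bar>M $ i $ j\<bar>)"
    by (intro sum_mono norm_le_l1_cart)
  also have "\<dots> \<le> (\<Sum>(i::'n)\<in>UNIV. \<Sum>(j::'m)\<in>UNIV. c)"
    by (intro sum_mono assms)
  finally show ?thesis by simp
qed

text \<open>
  A bounded set of matrices with a common denominator is finite. This makes the alphabet finite, and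
  it also leaves only finitely many candidates for the period sums of a periodic configuration.
\<close>

lemma finite_integer_matrices:
  fixes d r :: real
  assumes "d \<noteq> 0"
  shows "finite {M :: real^'m^'n. (\<forall>i j. d * M $ i $ j \<in> \<int>) \<and> norm M \<le> r}" (is "finite ?S")
proof -
  define I where "I = (\<lambda>z. z / d) ` {z \<in> \<int>. - (\<bar>d\<bar> * r) \<le> z \<and> z \<le> \<bar>d\<bar> * r}"
  have fI: "finite I"
    unfolding I_def by (intro finite_imageI finite_int_segment)
  have "M $ i $ j \<in> I" if "M \<in> ?S" for M :: "real^'m^'n" and i j
  proof -
    have "\<bar>M $ i $ j\<bar> \<le> r"
      using that component_le_norm_cart[of "M $ i" j] Finite_Cartesian_Product.norm_nth_le[of M i]
      by simp
    then have "\<bar>d * M $ i $ j\<bar> \<le> \<bar>d\<bar> * r"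
      by (simp add: abs_mult mult_left_mono)
    moreover have "d * M $ i $ j \<in> \<int>" "M $ i $ j = (d * M $ i $ j) / d"
      using that assms by auto
    ultimately show ?thesis
      unfolding I_def by (intro image_eqI[of _ _ "d * M $ i $ j"]) auto
  qed
  then have "?S \<subseteq> (\<lambda>f. \<chi> i j. f i j) ` (UNIV \<rightarrow> (UNIV \<rightarrow> I))"
    by (auto intro!: image_eqI[of M "\<lambda>f. \<chi> i j. f i j" "\<lambda>i j. M $ i $ j" for M])
  moreover have "finite ((UNIV::'n set) \<rightarrow> (UNIV::'m set) \<rightarrow> I)"
    using finite_PiE[of "UNIV::'n set" "\<lambda>_. (UNIV::'m set) \<rightarrow> I"]
      finite_PiE[of "UNIV::'m set" "\<lambda>_. I"] fI
    by (simp add: PiE_UNIV_domain)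
  ultimately show ?thesis
    by (meson finite_imageI finite_subset)
qed

lemma rational_matrix_denominator:
  fixes A :: "real^'m^'n"
  assumes "\<And>i j. A $ i $ j \<in> \<rat>"
  obtains d :: int where "d \<noteq> 0" "\<And>i j. of_int d * A $ i $ j \<in> \<int>"
proof -
  have "\<exists>d::int. d \<noteq> 0 \<and> of_int d * A $ i $ j \<in> \<int>" for i j
  proof -
    obtain p q where "A $ i $ j = of_int p / of_int q" "q > 0"
      using Rats_cases'[OF assms] by metis
    then show ?thesis by (intro exI[of _ q]) auto
  qed
  then obtain q :: "'n \<Rightarrow> 'm \<Rightarrow> int"
    where q: "\<And>i j. q i j \<noteq> 0" "\<And>i j. of_int (q i j) * A $ i $ j \<in> \<int>"
    by metis
  define d where "d = (\<Prod>p\<in>UNIV. q (fst p) (snd p))"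
  have "of_int d * A $ i $ j \<in> \<int>" for i j
  proof -
    \<comment> \<open>The factor belonging to the entry itself clears its denominator.\<close>
    have "d = (\<Prod>p\<in>UNIV - {(i, j)}. q (fst p) (snd p)) * q i j"
      unfolding d_def by (subst prod.remove[of _ "(i, j)"]) auto
    then have "of_int d * A $ i $ j
      = of_int (\<Prod>p\<in>UNIV - {(i, j)}. q (fst p) (snd p)) * (of_int (q i j) * A $ i $ j)"
      by (simp only: of_int_mult mult.assoc)
    then show ?thesis by (simp only: Ints_mult Ints_of_int q(2))
  qed
  moreover have "d \<noteq> 0" using q(1) by (simp add: d_def)
  ultimately show ?thesis using that by blast
qed

section \<open>Integer cubes of invertible matrices\<close>

text \<open>
  In all that follows, \<open>1\<close> is the matrix with all entries equal to one (\<open>mat 1\<close> is the identity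
  matrix) and the order on matrices is entrywise. So \<open>{u..u + 1}\<close> is the unit cube with lowest
  corner \<open>u\<close>.
\<close>

definition floor_matrix :: "real^'m^'n \<Rightarrow> real^'m^'n" where
  "floor_matrix M = (\<chi> i j. of_int \<lfloor>M $ i $ j\<rfloor>)"

lemma floor_matrix_bounds: "floor_matrix M \<le> M" "M \<le> floor_matrix M + 1"
  by (auto simp: floor_matrix_def less_eq_vec_def intro: less_imp_le)

text \<open>
  If all matrices within distance \<open>e\<close> of \<open>K\<close> are invertible and \<open>N\<close> is \<open>1 / e\<close> times the number of
  matrix entries, then a unit cube that meets \<open>N \<sqdot> K\<close> lies within distance \<open>N e\<close> of \<open>N \<sqdot> K\<close>. Only
  finitely many integer cubes meet the bounded set \<open>N \<sqdot> K\<close>.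
\<close>

lemma compact_invertible_cubes:
  fixes K :: "(real^'k^'k) set"
  assumes "compact K" "\<And>A. A \<in> K \<Longrightarrow> invertible A"
  obtains N :: real and U where "N > 0" "finite U"
    "\<And>A. A \<in> K \<Longrightarrow> floor_matrix (N *\<^sub>R A) \<in> U"
    "\<And>u i j. u \<in> U \<Longrightarrow> u $ i $ j \<in> \<int>"
    "\<And>u X. u \<in> U \<Longrightarrow> X \<in> {u..u+1} \<Longrightarrow> invertible X"
proof -
  have "continuous_on UNIV (det :: real^'k^'k \<Rightarrow> real)"
    unfolding det_def by (intro continuous_intros)
  then have "open (det -` (- {0}) :: (real^'k^'k) set)"
    by (intro open_vimage) auto
  moreover have "K \<subseteq> det -` (- {0})"
    using assms(2) invertible_det_nz by blast
  ultimately obtain e where e: "e > 0" "(\<Union>A\<in>K. cball A e) \<subseteq> det -` (- {0})"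
    using compact_subset_open_imp_cball_epsilon_subset[OF assms(1)] by metis
  define b where "b = real CARD('k) * (real CARD('k) * 1)"
  define N where "N = b / e"
  define U where "U = (\<lambda>A. floor_matrix (N *\<^sub>R A)) ` K"
  have b: "b > 0" by (simp add: b_def)
  then have N: "N > 0" using e by (simp add: N_def)
  have near: "norm (X - N *\<^sub>R A) \<le> b" if "X \<in> {floor_matrix (N *\<^sub>R A)..floor_matrix (N *\<^sub>R A) + 1}"
    for X A :: "real^'k^'k"
    unfolding b_def
  proof (rule norm_matrix_le)
    fix i j
    have "floor_matrix (N *\<^sub>R A) $ i $ j \<le> X $ i $ j"
      "X $ i $ j \<le> floor_matrix (N *\<^sub>R A) $ i $ j + 1"
      using that by (auto simp: less_eq_vec_def)
    moreover have "of_int \<lfloor>N * A $ i $ j\<rfloor> = floor_matrix (N *\<^sub>R A) $ i $ j"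
      by (simp add: floor_matrix_def)
    ultimately show "\<bar>(X - N *\<^sub>R A) $ i $ j\<bar> \<le> 1"
      by simp linarith
  qed
  show ?thesis
  proof (rule that[OF N, of U])
    obtain r where r: "\<And>A. A \<in> K \<Longrightarrow> norm A \<le> r"
      using compact_imp_bounded[OF assms(1)] by (auto simp: bounded_iff)
    have "norm u \<le> b + N * r" if "u \<in> U" for u
    proof -
      obtain A where A: "A \<in> K" "u = floor_matrix (N *\<^sub>R A)"
        using \<open>u \<in> U\<close> by (auto simp: U_def)
      have "norm (u - N *\<^sub>R A) \<le> b"
        using near[of u A] A by (simp add: less_eq_vec_def)
      moreover have "norm (N *\<^sub>R A) \<le> N * r"
        using r[OF A(1)] N by (simp add: mult_left_mono)
      ultimately show ?thesis
        using norm_triangle_sub[of u "N *\<^sub>R A"] by linarith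
    qed
    then have "U \<subseteq> {M. (\<forall>i j. 1 * M $ i $ j \<in> \<int>) \<and> norm M \<le> b + N * r}"
      by (auto simp: U_def floor_matrix_def)
    then show "finite U"
      by (rule finite_subset) (rule finite_integer_matrices, simp)
    show "floor_matrix (N *\<^sub>R A) \<in> U" if "A \<in> K" for A
      using that by (simp add: U_def)
    show "u $ i $ j \<in> \<int>" if "u \<in> U" for u i j
      using that by (auto simp: U_def floor_matrix_def)
    show "invertible X" if "u \<in> U" and X: "X \<in> {u..u+1}" for u X
    proof -
      obtain A where A: "A \<in> K" "u = floor_matrix (N *\<^sub>R A)"
        using \<open>u \<in> U\<close> by (auto simp: U_def)
      \<comment> \<open>Scaling down by \<open>N\<close> brings \<open>X\<close> within distance \<open>e\<close> of \<open>A\<close>.\<close>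
      have "A - X /\<^sub>R N = - (X - N *\<^sub>R A) /\<^sub>R N"
        using N by (simp add: algebra_simps)
      then have "dist A (X /\<^sub>R N) = norm (X - N *\<^sub>R A) / N"
        using N by (simp add: dist_norm divide_inverse norm_minus_commute)
      also have "\<dots> \<le> e"
        using near X A(2) N e(1) b by (simp add: N_def field_simps)
      finally have "X /\<^sub>R N \<in> (\<Union>A\<in>K. cball A e)"
        using A(1) by auto
      then have "X /\<^sub>R N \<in> det -` (- {0})"
        using e(2) by blast
      then have "invertible (X /\<^sub>R N)"
        by (simp add: invertible_det_nz)
      then show ?thesis
        using N by (simp add: invertible_scaleR_iff)
    qed
  qed
qed

section \<open>Matrix groups\<close>

lemma group_GL: "group (GL :: (real^'k^'k) monoid)"
  by (rule groupI)
    (auto simp: GL_def matrix_mul_assoc invertible_mult invertible_def[of "mat 1"] intro: exI[of _ "mat 1"],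
     auto simp: invertible_def)

locale matrix_group =
  fixes G :: "(real^'k^'k) set"
  assumes subgroup: "subgroup G GL"
begin

lemma one_mem: "mat 1 \<in> G"
  using subgroup.one_closed[OF subgroup] by (simp add: GL_def)

lemma mult_mem: "A \<in> G \<Longrightarrow> B \<in> G \<Longrightarrow> A ** B \<in> G"
  using subgroup.m_closed[OF subgroup] by (simp add: GL_def)

lemma invertible_mem: "A \<in> G \<Longrightarrow> invertible A"
  using subgroup.subset[OF subgroup] by (auto simp: GL_def)

lemma inv_mult: "A \<in> G \<Longrightarrow> matrix_inv A ** A = mat 1" "A \<in> G \<Longrightarrow> A ** matrix_inv A = mat 1"
  using invertible_mem by (auto simp: matrix_inv_mult)

lemma inv_GL: "A \<in> G \<Longrightarrow> inv\<^bsub>GL\<^esub> A = matrix_inv A"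
  using inv_mult invertible_mem
  by (intro group.inv_equality[OF group_GL]) (auto simp: GL_def invertible_def)

lemma inv_mem: "A \<in> G \<Longrightarrow> matrix_inv A \<in> G"
  using subgroup.m_inv_closed[OF subgroup] by (metis inv_GL)

lemma group_G: "group (GL\<lparr>carrier := G\<rparr>)"
  using subgroup.subgroup_is_group[OF subgroup group_GL] .

lemma inv_G: "A \<in> G \<Longrightarrow> inv\<^bsub>GL\<lparr>carrier := G\<rparr>\<^esub> A = matrix_inv A"
  using group.m_inv_consistent[OF group_GL subgroup] by (simp add: inv_GL)

lemma cancel: "A \<in> G \<Longrightarrow> matrix_inv A ** (A ** B) = B" "A \<in> G \<Longrightarrow> A ** (matrix_inv A ** B) = B"
  "A \<in> G \<Longrightarrow> B ** A ** matrix_inv A = B" "A \<in> G \<Longrightarrow> B ** matrix_inv A ** A = B"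
  by (simp_all add: matrix_mul_assoc[symmetric] inv_mult) (simp_all add: matrix_mul_assoc inv_mult)

lemma inv_inv: "A \<in> G \<Longrightarrow> matrix_inv (matrix_inv A) = A"
  by (rule matrix_inv_eqI) (auto simp: inv_mult)

lemma inv_mult_distrib: "A \<in> G \<Longrightarrow> B \<in> G \<Longrightarrow> matrix_inv (A ** B) = matrix_inv B ** matrix_inv A"
  by (rule matrix_inv_eqI) (auto simp: matrix_mul_assoc inv_mult cancel)

end

locale generated_matrix_group = matrix_group G for G :: "(real^'k^'k) set" +
  fixes S :: "(real^'k^'k) set"
  assumes finite_S: "finite S"
    and S_subset: "S \<subseteq> G"
    and generate_S: "generate (GL\<lparr>carrier := G\<rparr>) S = G"
begin

lemma generate_induct [consumes 1, case_names one gen inv mult]: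
  assumes "g \<in> G" "P (mat 1)" "\<And>s. s \<in> S \<Longrightarrow> P s" "\<And>s. s \<in> S \<Longrightarrow> P (matrix_inv s)"
    and "\<And>g h. g \<in> G \<Longrightarrow> h \<in> G \<Longrightarrow> P g \<Longrightarrow> P h \<Longrightarrow> P (g ** h)"
  shows "P g"
proof -
  have "g \<in> generate (GL\<lparr>carrier := G\<rparr>) S" using assms(1) generate_S by simp
  then show ?thesis
  proof (induction rule: generate.induct)
    case one
    then show ?case using assms(2) by (simp add: GL_def)
  next
    case (inv h)
    then show ?case using assms(4) S_subset by (metis inv_G subsetD)
  next
    case (eng h1 h2)
    then show ?case using assms(5) generate_S by (simp add: GL_def)
  qed (use assms(3) in simp)
qed

end

section \<open>Partial maps generated by a free action\<close>

definition map_on :: "'a set \<Rightarrow> ('a \<Rightarrow> 'b) \<Rightarrow> 'a \<rightharpoonup> 'b" where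
  "map_on A f x = (if x \<in> A then Some (f x) else None)"

lemma dom_map_on [simp]: "dom (map_on A f) = A"
  by (auto simp: map_on_def dom_def)

lemma ran_map_on [simp]: "ran (map_on A f) = f ` A"
  by (auto simp: map_on_def ran_def)

text \<open>
  A group acts on \<open>E\<close>, and its generators are used as partial maps with domain \<open>B\<close>, where the action
  is free. As \<open>B\<close> need not be invariant, composites may have smaller domains; that \<open>B\<close> contains the full
  orbit of \<open>t0\<close> keeps their common domain nonempty.
\<close>

locale generated_free_action =
  fixes Gr :: "('g, 'm) monoid_scheme" (structure) and S :: "'g set"
    and act :: "'g \<Rightarrow> 'x \<Rightarrow> 'x" and E B :: "'x set" and t0 :: 'x
  assumes group_Gr: "group Gr"
    and S_subset: "S \<subseteq> carrier Gr" and S_nonempty: "S \<noteq> {}"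
    and generate_S: "generate Gr S = carrier Gr"
    and act_closed: "\<And>g x. g \<in> carrier Gr \<Longrightarrow> x \<in> E \<Longrightarrow> act g x \<in> E"
    and act_one: "\<And>x. x \<in> E \<Longrightarrow> act \<one> x = x"
    and act_mult: "\<And>g h x. g \<in> carrier Gr \<Longrightarrow> h \<in> carrier Gr \<Longrightarrow> x \<in> E \<Longrightarrow>
      act (g \<otimes> h) x = act g (act h x)"
    and B_subset: "B \<subseteq> E"
    and free: "\<And>g x. g \<in> carrier Gr \<Longrightarrow> x \<in> B \<Longrightarrow> act g x = x \<Longrightarrow> g = \<one>"
    and t0_mem: "t0 \<in> E"
    and orbit: "\<And>g. g \<in> carrier Gr \<Longrightarrow> act g t0 \<in> B"
begin

sublocale group Gr by (rule group_Gr)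

abbreviation F where "F \<equiv> (\<lambda>s. map_on B (act s)) ` S"

text \<open>
  The second half says that the full orbit of \<open>t0\<close> lies in the domain. It has to be carried along in
  the inductions: it is closed under composition, whereas the bare statement that \<open>p\<close> is a restriction of
  the action of \<open>g\<close> says nothing about the size of the domain.
\<close>

definition realises :: "('x \<rightharpoonup> 'x) \<Rightarrow> 'g \<Rightarrow> bool" where
  "realises p g \<longleftrightarrow> g \<in> carrier Gr \<and> dom p \<subseteq> E \<and> (\<forall>x\<in>dom p. p x = Some (act g x)) \<and>
     (\<forall>h\<in>carrier Gr. act h t0 \<in> dom p)"

lemma act_inv: "g \<in> carrier Gr \<Longrightarrow> x \<in> E \<Longrightarrow> act (inv g) (act g x) = x"
  by (metis act_mult act_one inv_closed l_inv)

lemma act_inv': "g \<in> carrier Gr \<Longrightarrow> x \<in> E \<Longrightarrow> act g (act (inv g) x) = x"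
  using act_inv[of "inv g" x] by simp

lemma realises_generator: "s \<in> S \<Longrightarrow> realises (map_on B (act s)) s"
  using S_subset B_subset orbit by (auto simp: realises_def map_on_def)

lemma realises_inverse:
  assumes "s \<in> S"
  shows "realises (partial_inv (map_on B (act s))) (inv s)"
proof -
  have s: "s \<in> carrier Gr" using assms S_subset by blast
  have dom: "dom (partial_inv (map_on B (act s))) = act s ` B"
    by (auto simp: partial_inv_def dom_def split: if_splits)
  have "partial_inv (map_on B (act s)) (act s x) = Some (act (inv s) (act s x))" if "x \<in> B" for x
  proof -
    have "(THE x'. map_on B (act s) x' = Some (act s x)) = x"
    proof (rule the_equality)
      fix x' assume "map_on B (act s) x' = Some (act s x)"
      then have "x' \<in> B" "act s x' = act s x" by (auto simp: map_on_def split: if_splits)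
      then show "x' = x" using act_inv[OF s] that B_subset by (metis subsetD)
    qed (simp add: map_on_def that)
    then show ?thesis
      using act_inv[OF s] that B_subset by (auto simp: partial_inv_def)
  qed
  moreover have "act h t0 \<in> act s ` B" if "h \<in> carrier Gr" for h
    using that s orbit[of "inv s \<otimes> h"] act_inv'[OF s, of "act h t0"] t0_mem
    by (intro image_eqI[of _ _ "act (inv s \<otimes> h) t0"]) (auto simp: act_mult act_closed)
  ultimately show ?thesis
    unfolding realises_def dom using s B_subset act_closed by auto
qed

lemma realises_comp:
  assumes "realises p g" "realises q h"
  shows "realises (p \<circ>\<^sub>m q) (g \<otimes> h)"
proof -
  have q: "q x = Some (act h x)" "x \<in> E" if "x \<in> dom q" for x
    using assms(2) that by (auto simp: realises_def)
  have p: "p x = Some (act g x)" if "x \<in> dom p" for x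
    using assms(1) that by (auto simp: realises_def)
  have gh: "g \<in> carrier Gr" "h \<in> carrier Gr" using assms by (auto simp: realises_def)
  have dom: "x \<in> dom (p \<circ>\<^sub>m q) \<longleftrightarrow> x \<in> dom q \<and> act h x \<in> dom p" for x
    using q(1)[of x] by (cases "x \<in> dom q") (auto simp: map_comp_def domIff)
  have "(p \<circ>\<^sub>m q) x = Some (act (g \<otimes> h) x)" if "x \<in> dom (p \<circ>\<^sub>m q)" for x
    using that q[of x] p[of "act h x"] unfolding dom by (simp add: map_comp_def act_mult gh)
  moreover have "act k t0 \<in> dom (p \<circ>\<^sub>m q)" if "k \<in> carrier Gr" for k
    using assms that gh act_mult[OF gh(2) that t0_mem] m_closed[OF gh(2) that]
    by (metis dom realises_def)
  moreover have "dom (p \<circ>\<^sub>m q) \<subseteq> E"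
    using q(2) dom by blast
  ultimately show ?thesis
    unfolding realises_def using gh by blast
qed

text \<open>
  Every composite of generators and inverses is a restriction of the action of some group element;
  conversely, every group element arises in this way because each rule that generates the group has a
  counterpart for partial maps.
\<close>

lemma pmaps_realise: "p \<in> pmaps F \<Longrightarrow> \<exists>g. realises p g"
proof (induction rule: pmaps.induct)
  case (comp p q)
  then show ?case using realises_comp by blast
qed (use realises_generator realises_inverse in blast)+

lemma realised_by_pmaps: "g \<in> carrier Gr \<Longrightarrow> \<exists>p\<in>pmaps F. realises p g"
proof -
  assume "g \<in> carrier Gr"
  then have "g \<in> generate Gr S" using generate_S by simp
  then show ?thesis
  proof (induction rule: generate.induct)
    case one
    \<comment> \<open>The identity arises from the composite of a generator with its inverse.\<close>
    obtain s where s: "s \<in> S" using S_nonempty by blast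
    then have "realises (map_on B (act s) \<circ>\<^sub>m partial_inv (map_on B (act s))) \<one>"
      using realises_comp[OF realises_generator[OF s] realises_inverse[OF s]] S_subset
      by (metis r_inv subsetD)
    then show ?case using s by (meson imageI pmaps.intros)
  next
    case (incl s)
    then show ?case using realises_generator by (meson imageI pmaps.base)
  next
    case (inv s)
    then show ?case using realises_inverse by (meson imageI pmaps.inverse)
  next
    case (eng g h)
    then show ?case using realises_comp by (meson pmaps.comp)
  qed
qed

lemma common_dom_subset: "common_dom F \<subseteq> B"
proof -
  obtain s where "s \<in> S" using S_nonempty by blast
  then have "map_on B (act s) \<in> pmaps F" by (intro pmaps.base imageI)
  then show ?thesis unfolding common_dom_def by (metis INT_lower dom_map_on)
qed

lemma orbit_common_dom: "g \<in> carrier Gr \<Longrightarrow> act g t0 \<in> common_dom F"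
  using pmaps_realise by (fastforce simp: common_dom_def realises_def)

text \<open>
  If \<open>p\<close> realises \<open>g\<close>, then \<open>q \<circ>\<^sub>m p\<close> is again one of the partial maps for each \<open>q\<close>, so it is defined at \<open>t\<close>;
  that is, \<open>q\<close> is defined at \<open>g t\<close>.
\<close>

lemma common_dom_invariant:
  assumes g: "g \<in> carrier Gr" and t: "t \<in> common_dom F"
  shows "act g t \<in> common_dom F"
  unfolding common_dom_def
proof
  fix q assume q: "q \<in> pmaps F"
  obtain p where p: "p \<in> pmaps F" "realises p g" using realised_by_pmaps[OF g] by blast
  have "t \<in> dom p" "t \<in> dom (q \<circ>\<^sub>m p)"
    using t p(1) pmaps.comp[OF q p(1)] by (auto simp: common_dom_def)
  then show "act g t \<in> dom q"
    using p(2) by (auto simp: realises_def map_comp_def domIff)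
qed

lemma restrict_realising:
  assumes "p \<in> pmaps F" "realises p g"
  shows "p |` common_dom F = map_on (common_dom F) (act g)"
proof
  fix x
  have "x \<in> dom p" if "x \<in> common_dom F" using that assms(1) by (auto simp: common_dom_def)
  then show "(p |` common_dom F) x = map_on (common_dom F) (act g) x"
    using assms(2) by (auto simp: restrict_map_def map_on_def realises_def)
qed

lemma carrier_pmap_group:
  "carrier (pmap_group F) = (\<lambda>g. map_on (common_dom F) (act g)) ` carrier Gr"
proof -
  have "p |` common_dom F \<in> (\<lambda>g. map_on (common_dom F) (act g)) ` carrier Gr" if "p \<in> pmaps F" for p
    using pmaps_realise[OF that] restrict_realising[OF that] by (auto simp: realises_def)
  moreover have "\<exists>p\<in>pmaps F. map_on (common_dom F) (act g) = p |` common_dom F"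
    if "g \<in> carrier Gr" for g
    using realised_by_pmaps[OF that] restrict_realising by metis
  ultimately show ?thesis unfolding pmap_group_def by auto
qed

lemma one_pmap_group: "\<one>\<^bsub>pmap_group F\<^esub> = map_on (common_dom F) (act \<one>)"
  using common_dom_subset B_subset act_one
  by (auto simp: pmap_group_def restrict_map_def map_on_def fun_eq_iff)

text \<open>
  Restricted to the invariant common domain the partial maps compose like group elements. Distinct
  elements stay distinct, since they already differ on the orbit of \<open>t0\<close>, on which the action is free.
\<close>

lemma pmap_group_iso: "Gr \<cong> pmap_group F"
proof -
  have "map_on (common_dom F) (act (g \<otimes> h)) = map_on (common_dom F) (act g) \<circ>\<^sub>m map_on (common_dom F) (act h)"
    if "g \<in> carrier Gr" "h \<in> carrier Gr" for g h
    using that common_dom_invariant common_dom_subset B_subset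
    by (auto simp: map_on_def map_comp_def fun_eq_iff act_mult subset_iff)
  moreover have "inj_on (\<lambda>g. map_on (common_dom F) (act g)) (carrier Gr)"
  proof (rule inj_onI)
    fix g h
    assume gh: "g \<in> carrier Gr" "h \<in> carrier Gr"
      and eq: "map_on (common_dom F) (act g) = map_on (common_dom F) (act h)"
    let ?t = "act \<one> t0"
    have t: "?t \<in> common_dom F" "?t \<in> B" "?t \<in> E"
      using orbit_common_dom common_dom_subset B_subset by auto
    have "act g ?t = act h ?t"
      using fun_cong[OF eq, of ?t] t(1) by (simp add: map_on_def)
    then have "act (inv h \<otimes> g) ?t = ?t"
      using gh t(3) by (simp add: act_mult act_inv)
    then have "inv h \<otimes> g = \<one>" using free gh t(2) by blast
    then show "g = h" using gh by (metis inv_equality inv_inv inv_closed)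
  qed
  ultimately have "(\<lambda>g. map_on (common_dom F) (act g)) \<in> iso Gr (pmap_group F)"
    by (auto simp: iso_def hom_def bij_betw_def carrier_pmap_group) (simp add: pmap_group_def)
  then show ?thesis by (rule is_isoI)
qed

text \<open>
  By freeness it is enough that \<open>g\<close> fixes \<open>t\<close>, the case where \<open>f\<close> is the identity.
\<close>

lemma pmap_group_faithful_on_orbits:
  assumes "t \<in> common_dom F" "g \<in> carrier (pmap_group F)"
    and fixes_orbit: "\<forall>f\<in>carrier (pmap_group F). (g \<circ>\<^sub>m f) t = f t"
  shows "g = \<one>\<^bsub>pmap_group F\<^esub>"
proof -
  obtain k where k: "k \<in> carrier Gr" "g = map_on (common_dom F) (act k)"
    using assms(2) carrier_pmap_group by auto
  have t: "t \<in> B" "t \<in> E" using assms(1) common_dom_subset B_subset by auto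
  have "map_on (common_dom F) (act \<one>) \<in> carrier (pmap_group F)"
    by (simp add: carrier_pmap_group)
  then have "act k t = t"
    using fixes_orbit assms(1) t by (fastforce simp: map_on_def map_comp_def k(2) act_one)
  then show ?thesis
    using free[OF k(1) t(1)] k(2) one_pmap_group by simp
qed

end

section \<open>Rational polytopes and rational affine maps\<close>

text \<open>
  Substituting the affine map into a rational linear inequality gives a rational linear inequality.
\<close>

lemma rational_polytope_preimage:
  assumes "rational_polytope n P"
  shows "rational_polytope n {x \<in> topspace (Euclidean_space n). rational_affine n M b x \<in> P}"
proof -
  obtain C where C: "finite C" "P = {x \<in> topspace (Euclidean_space n).
      \<forall>(a, c)\<in>C. (\<Sum>i<n. of_rat (a i) * x i) \<le> of_rat c}"
    using assms unfolding rational_polytope_def by blast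
  define pull where "pull = (\<lambda>(a, c). (\<lambda>j. \<Sum>i<n. a i * M i j, c - (\<Sum>i<n. a i * b i)))"
  have "(\<Sum>i<n. of_rat (a i) * rational_affine n M b x i) \<le> of_rat c \<longleftrightarrow>
      (\<Sum>j<n. of_rat (\<Sum>i<n. a i * M i j) * x j) \<le> of_rat (c - (\<Sum>i<n. a i * b i))"
    for a c and x :: "nat \<Rightarrow> real"
  proof -
    have "(\<Sum>i<n. of_rat (a i) * rational_affine n M b x i)
      = (\<Sum>i<n. (\<Sum>j<n. of_rat (a i) * of_rat (M i j) * x j)) + (\<Sum>i<n. of_rat (a i) * of_rat (b i))"
      by (simp add: rational_affine_def sum_distrib_left distrib_left sum.distrib mult.assoc)
    also have "(\<Sum>i<n. (\<Sum>j<n. of_rat (a i) * of_rat (M i j) * x j))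
      = (\<Sum>j<n. of_rat (\<Sum>i<n. a i * M i j) * x j)"
      by (subst sum.swap) (simp add: of_rat_sum of_rat_mult sum_distrib_right)
    finally show ?thesis
      by (simp add: of_rat_diff of_rat_sum of_rat_mult le_diff_eq)
  qed
  moreover have "rational_affine n M b x \<in> topspace (Euclidean_space n)" for x
    by (simp add: topspace_Euclidean_space rational_affine_def)
  ultimately have "{x \<in> topspace (Euclidean_space n). rational_affine n M b x \<in> P}
    = {x \<in> topspace (Euclidean_space n). \<forall>(a, c)\<in>pull ` C. (\<Sum>i<n. of_rat (a i) * x i) \<le> of_rat c}"
    unfolding C(2) by (auto simp: pull_def case_prod_beta)
  then show ?thesis
    unfolding rational_polytope_def using C(1) by blast
qed

text \<open>
  The image under an invertible affine map is the preimage under its inverse.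
\<close>

lemma bounded_rational_polytope_image:
  assumes P: "bounded_rational_polytope n P"
    and inv: "\<And>x. x \<in> topspace (Euclidean_space n) \<Longrightarrow> rational_affine n M' b' (rational_affine n M b x) = x"
      "\<And>x. x \<in> topspace (Euclidean_space n) \<Longrightarrow> rational_affine n M b (rational_affine n M' b' x) = x"
  shows "bounded_rational_polytope n (rational_affine n M b ` P)"
proof -
  have PE: "P \<subseteq> topspace (Euclidean_space n)"
    using P by (auto simp: bounded_rational_polytope_def rational_polytope_def)
  have E: "rational_affine n M b x \<in> topspace (Euclidean_space n)" for M b x
    by (simp add: topspace_Euclidean_space rational_affine_def)
  have "rational_affine n M b ` P = {y \<in> topspace (Euclidean_space n). rational_affine n M' b' y \<in> P}"
  proof (intro equalityI subsetI)
    fix y assume "y \<in> {y \<in> topspace (Euclidean_space n). rational_affine n M' b' y \<in> P}"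
    then show "y \<in> rational_affine n M b ` P"
      by (intro image_eqI[of _ _ "rational_affine n M' b' y"]) (auto simp: inv)
  qed (use PE inv E in auto)
  then have "rational_polytope n (rational_affine n M b ` P)"
    using rational_polytope_preimage[of n P M' b'] P by (simp add: bounded_rational_polytope_def)
  moreover obtain r where r: "\<And>x i. x \<in> P \<Longrightarrow> i < n \<Longrightarrow> \<bar>x i\<bar> \<le> r"
    using P by (auto simp: bounded_rational_polytope_def)
  have "\<bar>rational_affine n M b x i\<bar> \<le> (\<Sum>i<n. (\<Sum>j<n. \<bar>of_rat (M i j)\<bar> * r) + \<bar>of_rat (b i)\<bar>)"
    if x: "x \<in> P" and i: "i < n" for x i
  proof -
    have r0: "0 \<le> r" using r[OF x i] by linarith
    have "\<bar>rational_affine n M b x i\<bar> \<le> \<bar>\<Sum>j<n. of_rat (M i j) * x j\<bar> + \<bar>of_rat (b i)\<bar>"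
      using i unfolding rational_affine_def by (simp only: if_True abs_triangle_ineq)
    also have "\<bar>\<Sum>j<n. of_rat (M i j) * x j\<bar> \<le> (\<Sum>j<n. \<bar>of_rat (M i j) * x j\<bar>)"
      by (rule sum_abs)
    also have "\<dots> \<le> (\<Sum>j<n. \<bar>of_rat (M i j)\<bar> * r)"
      using r[OF x] by (intro sum_mono) (auto simp: abs_mult intro!: mult_left_mono)
    also have "(\<Sum>j<n. \<bar>of_rat (M i j)\<bar> * r) + \<bar>of_rat (b i)\<bar>
      \<le> (\<Sum>i<n. (\<Sum>j<n. \<bar>of_rat (M i j)\<bar> * r) + \<bar>of_rat (b i)\<bar>)"
      using i r0 by (intro member_le_sum[of i "{..<n}" "\<lambda>i. (\<Sum>j<n. \<bar>of_rat (M i j)\<bar> * r) + \<bar>of_rat (b i)\<bar>"])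
        (auto intro!: add_nonneg_nonneg sum_nonneg)
    finally show ?thesis by simp
  qed
  ultimately show ?thesis
    unfolding bounded_rational_polytope_def by blast
qed

lemma continuous_map_rational_affine:
  "continuous_map (Euclidean_space n) (Euclidean_space n) (rational_affine n M b)"
proof -
  have coord: "continuous_map (Euclidean_space n) euclideanreal (\<lambda>x. x i)" for i
    unfolding Euclidean_space_def
    by (intro continuous_map_from_subtopology continuous_map_product_coordinates) simp
  have "continuous_map (Euclidean_space n) (powertop_real UNIV) (rational_affine n M b)"
    unfolding continuous_map_componentwise_UNIV
  proof
    fix i
    show "continuous_map (Euclidean_space n) euclideanreal (\<lambda>x. rational_affine n M b x i)"
      by (cases "i < n") (auto simp: rational_affine_def intro!: continuous_map_add continuous_map_sum
          continuous_map_real_mult coord)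
  qed
  then show ?thesis
    unfolding Euclidean_space_def[of n]
    by (subst continuous_map_in_subtopology) (auto simp: Euclidean_space_def rational_affine_def)
qed

lemma pa_rational_homeo_map_on:
  assumes \<P>: "finite \<P>" "\<And>P. P \<in> \<P> \<Longrightarrow> bounded_rational_polytope n P"
    and inv: "\<And>x. x \<in> topspace (Euclidean_space n) \<Longrightarrow> rational_affine n M' b' (rational_affine n M b x) = x"
      "\<And>x. x \<in> topspace (Euclidean_space n) \<Longrightarrow> rational_affine n M b (rational_affine n M' b' x) = x"
  shows "pa_rational_homeo n (map_on (\<Union>\<P>) (rational_affine n M b))"
proof -
  let ?f = "map_on (\<Union>\<P>) (rational_affine n M b)"
  have PE: "\<Union>\<P> \<subseteq> topspace (Euclidean_space n)"
    using \<P>(2) by (fastforce simp: bounded_rational_polytope_def rational_polytope_def)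
  have "homeomorphic_maps (Euclidean_space n) (Euclidean_space n)
      (rational_affine n M b) (rational_affine n M' b')"
    using inv by (simp add: homeomorphic_maps_def continuous_map_rational_affine)
  then have "homeomorphic_map (Euclidean_space n) (Euclidean_space n) (rational_affine n M b)"
    using homeomorphic_map_maps by blast
  then have "homeomorphic_map (subtopology (Euclidean_space n) (\<Union>\<P>))
      (subtopology (Euclidean_space n) (rational_affine n M b ` \<Union>\<P>)) (rational_affine n M b)"
  proof (rule homeomorphic_map_subtopologies)
    have "rational_affine n M b ` \<Union>\<P> \<subseteq> topspace (Euclidean_space n)"
      by (auto simp: topspace_Euclidean_space rational_affine_def)
    then show "rational_affine n M b ` (topspace (Euclidean_space n) \<inter> \<Union>\<P>)
      = topspace (Euclidean_space n) \<inter> rational_affine n M b ` \<Union>\<P>"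
      using PE by (simp add: Int_absorb1 Int_absorb2)
  qed
  then have "homeomorphic_map (subtopology (Euclidean_space n) (dom ?f))
      (subtopology (Euclidean_space n) (ran ?f)) (the \<circ> ?f)"
    by (simp only: dom_map_on ran_map_on) (erule homeomorphic_map_eq, simp add: map_on_def)
  moreover have "\<exists>\<Q>. finite \<Q> \<and> (\<forall>Q\<in>\<Q>. bounded_rational_polytope n Q) \<and> ran ?f = \<Union>\<Q>"
  proof (intro exI conjI ballI)
    show "finite ((`) (rational_affine n M b) ` \<P>)" using \<P>(1) by simp
    show "ran ?f = \<Union>((`) (rational_affine n M b) ` \<P>)" by auto
    show "bounded_rational_polytope n Q" if "Q \<in> (`) (rational_affine n M b) ` \<P>" for Q
      using that bounded_rational_polytope_image[OF \<P>(2) inv] by auto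
  qed
  moreover have "\<forall>P\<in>\<P>. \<exists>M b. \<forall>x\<in>P. ?f x = Some (rational_affine n M b x)"
    by (auto simp: map_on_def)
  ultimately show ?thesis
    unfolding pa_rational_homeo_def using \<P> by (metis dom_map_on)
qed

lemma bounded_rational_polytope_box:
  fixes l h :: "nat \<Rightarrow> rat"
  shows "bounded_rational_polytope n
    {x \<in> topspace (Euclidean_space n). \<forall>i<n. of_rat (l i) \<le> x i \<and> x i \<le> of_rat (h i)}"
    (is "bounded_rational_polytope n ?P")
proof -
  define C :: "((nat \<Rightarrow> rat) \<times> rat) set"
    where "C = (\<Union>i<n. {(\<lambda>j. if j = i then 1 else 0, h i), (\<lambda>j. if j = i then - 1 else 0, - l i)})"
  have "(\<Sum>j<n. of_rat (if j = i then 1 else 0) * x j) = x i"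
    "(\<Sum>j<n. of_rat (if j = i then - 1 else 0) * x j) = - x i" if "i < n" for x :: "nat \<Rightarrow> real" and i
    using that by (simp_all add: if_distrib[of of_rat] if_distrib[of "\<lambda>y. y * _"] cong: if_cong)
  then have "?P = {x \<in> topspace (Euclidean_space n). \<forall>(a, c)\<in>C. (\<Sum>i<n. of_rat (a i) * x i) \<le> of_rat c}"
    unfolding C_def by (auto simp: of_rat_minus)
  moreover have "finite C" by (simp add: C_def)
  ultimately have "rational_polytope n ?P"
    unfolding rational_polytope_def by blast
  moreover have "\<bar>x i\<bar> \<le> (\<Sum>i<n. \<bar>of_rat (l i)\<bar> + \<bar>of_rat (h i)\<bar>)" if "x \<in> ?P" "i < n" for x i
  proof -
    have "of_rat (l i) \<le> x i" "x i \<le> of_rat (h i)" using that by auto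
    then have "\<bar>x i\<bar> \<le> \<bar>of_rat (l i)\<bar> + \<bar>of_rat (h i)\<bar>" by linarith
    also have "\<dots> \<le> (\<Sum>i<n. \<bar>of_rat (l i)\<bar> + \<bar>of_rat (h i)\<bar>)"
      using that by (intro member_le_sum[of i "{..<n}" "\<lambda>i. \<bar>of_rat (l i)\<bar> + \<bar>of_rat (h i)\<bar>"]) auto
    finally show ?thesis .
  qed
  ultimately show ?thesis
    unfolding bounded_rational_polytope_def by blast
qed

section \<open>Matrix groups acting on a Euclidean space\<close>

text \<open>
  The enumeration \<open>e\<close> of the index pairs turns matrices into vectors of length \<open>n\<close>, padded with
  zeros to a sequence, and back.
\<close>

definition flatten :: "(nat \<Rightarrow> 'k::finite \<times> 'k) \<Rightarrow> nat \<Rightarrow> real^'k^'k \<Rightarrow> nat \<Rightarrow> real" where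
  "flatten e n X = (\<lambda>i. if i < n then X $ fst (e i) $ snd (e i) else 0)"

definition unflatten :: "(nat \<Rightarrow> 'k::finite \<times> 'k) \<Rightarrow> nat \<Rightarrow> (nat \<Rightarrow> real) \<Rightarrow> real^'k^'k" where
  "unflatten e n x = (\<chi> i j. x (inv_into {..<n} e (i, j)))"

locale matrix_coordinates =
  fixes e :: "nat \<Rightarrow> 'k::finite \<times> 'k" and n :: nat
  assumes e: "bij_betw e {..<n} UNIV"
begin

lemma flatten_mem: "flatten e n X \<in> topspace (Euclidean_space n)"
  by (simp add: flatten_def topspace_Euclidean_space)

lemma unflatten_nth: "i < n \<Longrightarrow> unflatten e n x $ fst (e i) $ snd (e i) = x i"
  using bij_betw_inv_into_left[OF e] by (simp add: unflatten_def)

lemma flatten_unflatten: "x \<in> topspace (Euclidean_space n) \<Longrightarrow> flatten e n (unflatten e n x) = x"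
  by (auto simp: flatten_def unflatten_nth topspace_Euclidean_space fun_eq_iff not_less)

lemma all_entries_iff: "(\<forall>i j. Q i j) \<longleftrightarrow> (\<forall>m<n. Q (fst (e m)) (snd (e m)))"
proof
  assume R: "\<forall>m<n. Q (fst (e m)) (snd (e m))"
  show "\<forall>i j. Q i j"
  proof (intro allI)
    fix i j
    have "(i, j) \<in> e ` {..<n}" using bij_betw_imp_surj_on[OF e] by simp
    then obtain m where "m < n" "e m = (i, j)" by auto
    then show "Q i j" using R by (metis fst_conv snd_conv)
  qed
qed simp

lemma unflatten_flatten: "unflatten e n (flatten e n X) = X"
proof -
  have "\<forall>i j. unflatten e n (flatten e n X) $ i $ j = X $ i $ j"
    unfolding all_entries_iff by (simp add: unflatten_nth) (simp add: flatten_def)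
  then show ?thesis by (simp add: vec_eq_iff)
qed

text \<open>
  In coordinates, left multiplication by \<open>A\<close> has the matrix of the tensor product of \<open>A\<close> with the
  identity: the entry for two index pairs vanishes unless they belong to the same column.
\<close>

lemma left_multiplication_rational_affine:
  fixes A :: "real^'k^'k"
  assumes "\<And>i j. A $ i $ j \<in> \<rat>"
  obtains M where "\<And>x. flatten e n (A ** unflatten e n x) = rational_affine n M (\<lambda>_. 0) x"
proof -
  have "\<forall>i j. \<exists>q. A $ i $ j = of_rat q"
    using assms by (auto simp: Rats_def)
  then obtain R where R: "\<And>i j. A $ i $ j = of_rat (R i j)" by metis
  define M where "M p q = (if snd (e p) = snd (e q) then R (fst (e p)) (fst (e q)) else 0)" for p q
  have "flatten e n (A ** unflatten e n x) = rational_affine n M (\<lambda>_. 0) x" for x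
  proof
    fix p
    show "flatten e n (A ** unflatten e n x) p = rational_affine n M (\<lambda>_. 0) x p"
    proof (cases "p < n")
      case True
      have "(\<Sum>q<n. of_rat (M p q) * x q)
        = (\<Sum>q<n. (\<lambda>(i, j). (if snd (e p) = j then A $ fst (e p) $ i else 0) * unflatten e n x $ i $ j) (e q))"
        by (rule sum.cong) (auto simp: M_def R unflatten_nth case_prod_beta)
      also have "\<dots> = (\<Sum>(i, j)\<in>UNIV. (if snd (e p) = j then A $ fst (e p) $ i else 0) * unflatten e n x $ i $ j)"
        by (rule sum.reindex_bij_betw[OF e])
      also have "\<dots> = (\<Sum>i\<in>UNIV. \<Sum>j\<in>UNIV. (if snd (e p) = j then A $ fst (e p) $ i else 0) * unflatten e n x $ i $ j)"
        by (simp add: sum.cartesian_product UNIV_Times_UNIV)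
      also have "\<dots> = (\<Sum>i\<in>UNIV. A $ fst (e p) $ i * unflatten e n x $ i $ snd (e p))"
        by (simp add: if_distrib[of "\<lambda>y. y * _"] cong: if_cong)
      finally show ?thesis
        using True by (simp add: flatten_def rational_affine_def matrix_matrix_mult_def)
    qed (simp add: flatten_def rational_affine_def)
  qed
  then show ?thesis using that by blast
qed

lemma bounded_rational_polytope_cube:
  assumes "\<And>i j. v $ i $ j \<in> \<int>"
  shows "bounded_rational_polytope n {x \<in> topspace (Euclidean_space n). unflatten e n x \<in> {v..v+1}}"
proof -
  define l where "l m = rat_of_int \<lfloor>v $ fst (e m) $ snd (e m)\<rfloor>" for m
  have "of_rat (l m) = v $ fst (e m) $ snd (e m)" for m
    using assms by (simp add: l_def)
  then have "unflatten e n x \<in> {v..v+1} \<longleftrightarrow> (\<forall>m<n. of_rat (l m) \<le> x m \<and> x m \<le> of_rat (l m + 1))" for x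
    using all_entries_iff[of "\<lambda>i j. v $ i $ j \<le> unflatten e n x $ i $ j \<and> unflatten e n x $ i $ j \<le> (v + 1) $ i $ j"]
    by (auto simp: less_eq_vec_def unflatten_nth of_rat_add)
  then show ?thesis
    using bounded_rational_polytope_box[of n l "\<lambda>m. l m + 1"] by simp
qed

end

text \<open>
  The orbit contained in the union of the cubes is that of \<open>N\<close> times the identity matrix: the element
  \<open>g\<close> moves it to \<open>N \<sqdot> g\<close>, which lies in the cube at \<open>floor_matrix (N \<sqdot> g)\<close>. The identity matrix
  is added to the generators because the partial maps must form a nonempty set.
\<close>

lemma (in generated_matrix_group) PA'_recognizable_G:
  assumes rat: "\<And>A i j. A \<in> G \<Longrightarrow> A $ i $ j \<in> \<rat>"
    and U: "finite U" "\<And>v i j. v \<in> U \<Longrightarrow> v $ i $ j \<in> \<int>"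
      "\<And>g. g \<in> G \<Longrightarrow> floor_matrix (N *\<^sub>R g) \<in> U"
      "\<And>v X. v \<in> U \<Longrightarrow> X \<in> {v..v+1} \<Longrightarrow> invertible X"
  shows "PA'_recognizable (GL\<lparr>carrier := G\<rparr>)"
proof -
  define n where "n = CARD('k \<times> 'k)"
  obtain e :: "nat \<Rightarrow> 'k \<times> 'k" where "bij_betw e {..<n} UNIV"
    using ex_bij_betw_nat_finite[of "UNIV :: ('k \<times> 'k) set"] by (auto simp: n_def atLeast0LessThan)
  then interpret matrix_coordinates e n by unfold_locales
  let ?E = "topspace (Euclidean_space n)"
  define act where "act g x = flatten e n (g ** unflatten e n x)" for g x
  define cube where "cube v = {x \<in> ?E. unflatten e n x \<in> {v..v+1}}" for v
  define S' where "S' = insert (mat 1) S"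
  have S': "S' \<subseteq> G" "generate (GL\<lparr>carrier := G\<rparr>) S' = G"
  proof -
    interpret G: group "GL\<lparr>carrier := G\<rparr>" by (rule group_G)
    show "S' \<subseteq> G" using S_subset one_mem by (simp add: S'_def)
    then have "generate (GL\<lparr>carrier := G\<rparr>) S' \<subseteq> G"
      using G.generate_incl[of S'] by simp
    moreover have "G \<subseteq> generate (GL\<lparr>carrier := G\<rparr>) S'"
      using G.mono_generate[of S S'] generate_S by (auto simp: S'_def)
    ultimately show "generate (GL\<lparr>carrier := G\<rparr>) S' = G" by blast
  qed
  interpret A: generated_free_action "GL\<lparr>carrier := G\<rparr>" S' act ?E "\<Union>(cube ` U)" "flatten e n (N *\<^sub>R mat 1)"
  proof (rule generated_free_action.intro)
    show "group (GL\<lparr>carrier := G\<rparr>)" by (rule group_G)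
    show "S' \<subseteq> carrier (GL\<lparr>carrier := G\<rparr>)" "generate (GL\<lparr>carrier := G\<rparr>) S' = carrier (GL\<lparr>carrier := G\<rparr>)"
      using S' by simp_all
    show "S' \<noteq> {}" by (simp add: S'_def)
    show "act g x \<in> ?E" for g x by (simp add: act_def flatten_mem)
    show "act \<one>\<^bsub>GL\<lparr>carrier := G\<rparr>\<^esub> x = x" if "x \<in> ?E" for x
      using that by (simp add: act_def GL_def flatten_unflatten)
    show "act (g \<otimes>\<^bsub>GL\<lparr>carrier := G\<rparr>\<^esub> h) x = act g (act h x)" for g h x
      by (simp add: act_def GL_def unflatten_flatten matrix_mul_assoc)
    show "\<Union>(cube ` U) \<subseteq> ?E" by (auto simp: cube_def)
    show "flatten e n (N *\<^sub>R mat 1) \<in> ?E" by (rule flatten_mem)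
    show "act g (flatten e n (N *\<^sub>R mat 1)) \<in> \<Union>(cube ` U)" if "g \<in> carrier (GL\<lparr>carrier := G\<rparr>)" for g
    proof -
      have "act g (flatten e n (N *\<^sub>R mat 1)) = flatten e n (N *\<^sub>R g)"
        by (simp add: act_def unflatten_flatten matrix_mult_left_simps)
      moreover have "flatten e n (N *\<^sub>R g) \<in> cube (floor_matrix (N *\<^sub>R g))"
        using floor_matrix_bounds by (auto simp: cube_def flatten_mem unflatten_flatten)
      ultimately show ?thesis using U(3) that by auto
    qed
    show "g = \<one>\<^bsub>GL\<lparr>carrier := G\<rparr>\<^esub>" if g: "x \<in> \<Union>(cube ` U)" "act g x = x" for g x
    proof -
      let ?X = "unflatten e n x"
      have "invertible ?X" using g(1) U(4) by (auto simp: cube_def)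
      \<comment> \<open>Cancelling the invertible matrix \<open>?X\<close> is where freeness comes from.\<close>
      have "g ** ?X = ?X"
        using arg_cong[OF g(2), of "unflatten e n"] by (simp add: act_def unflatten_flatten)
      then have "g ** ?X ** matrix_inv ?X = mat 1"
        by (simp add: matrix_inv_mult \<open>invertible ?X\<close>)
      then show ?thesis
        by (simp add: matrix_mul_assoc[symmetric] matrix_inv_mult \<open>invertible ?X\<close> GL_def)
    qed
  qed
  have "pa_rational_homeo n (map_on (\<Union>(cube ` U)) (act s))" if "s \<in> S'" for s
  proof -
    have s: "s \<in> G" using that S' by blast
    obtain M where M: "\<And>x. act s x = rational_affine n M (\<lambda>_. 0) x"
      using left_multiplication_rational_affine[OF rat[OF s]] unfolding act_def by metis
    obtain M' where M': "\<And>x. act (matrix_inv s) x = rational_affine n M' (\<lambda>_. 0) x"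
      using left_multiplication_rational_affine[OF rat[OF inv_mem[OF s]]] unfolding act_def by metis
    have "act s = rational_affine n M (\<lambda>_. 0)" using M by blast
    moreover have "pa_rational_homeo n (map_on (\<Union>(cube ` U)) (rational_affine n M (\<lambda>_. 0)))"
    proof (rule pa_rational_homeo_map_on)
      show "finite (cube ` U)" using U(1) by simp
      show "bounded_rational_polytope n P" if "P \<in> cube ` U" for P
        using that bounded_rational_polytope_cube U(2) by (auto simp: cube_def)
      fix x assume x: "x \<in> ?E"
      show "rational_affine n M' (\<lambda>_. 0) (rational_affine n M (\<lambda>_. 0) x) = x"
        "rational_affine n M (\<lambda>_. 0) (rational_affine n M' (\<lambda>_. 0) x) = x"
        using A.act_inv[of s x] A.act_inv'[of s x] s x by (simp_all add: inv_G M M')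
    qed
    ultimately show ?thesis by simp
  qed
  moreover have "finite A.F" using finite_S by (simp add: S'_def)
  moreover have "fin_gen (GL\<lparr>carrier := G\<rparr>)"
    using finite_S S_subset generate_S by (auto simp: fin_gen_def)
  ultimately show ?thesis
    unfolding PA'_recognizable_def
    using group_G A.pmap_group_iso A.pmap_group_faithful_on_orbits by blast
qed

section \<open>Subshifts given by a rule on a finite window\<close>

text \<open>
  A condition on the pattern seen through a finite window defines a subshift of finite type: the forbidden
  patterns are those violating the condition. The alphabet may have any type, as its symbols can be
  numbered.
\<close>

lemma admits_strongly_aperiodic_SFT_if_window_rule:
  fixes H :: "('g, 'm) monoid_scheme" and A :: "'b set"
  assumes "group H" "finite A" "finite D" "D \<subseteq> carrier H"
    and x0: "x0 \<in> carrier H \<rightarrow> A"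
      "\<And>h. h \<in> carrier H \<Longrightarrow> P (\<lambda>d\<in>D. x0 (h \<otimes>\<^bsub>H\<^esub> d))"
    and fin: "\<And>x. x \<in> carrier H \<rightarrow> A \<Longrightarrow>
      (\<And>h. h \<in> carrier H \<Longrightarrow> P (\<lambda>d\<in>D. x (h \<otimes>\<^bsub>H\<^esub> d))) \<Longrightarrow>
      finite {g \<in> carrier H. \<forall>h\<in>carrier H. x (inv\<^bsub>H\<^esub> g \<otimes>\<^bsub>H\<^esub> h) = x h}"
  shows "admits_strongly_aperiodic_SFT H"
proof -
  interpret H: group H by fact
  obtain e :: "'b \<Rightarrow> nat" where e: "inj_on e A"
    using finite_imp_inj_to_nat_seg[OF \<open>finite A\<close>] by blast
  define dec where "dec = inv_into A e"
  have dec: "dec (e a) = a" if "a \<in> A" for a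
    using e that by (simp add: dec_def)
  have dec': "dec n \<in> A" if "n \<in> e ` A" for n
    using that by (simp add: dec_def inv_into_into)
  define L where "L = {w. dom w = D \<and> ran w \<subseteq> e ` A \<and> \<not> P (\<lambda>d\<in>D. dec (the (w d)))}"
  define X where "X = {x \<in> carrier H \<rightarrow>\<^sub>E e ` A.
    \<forall>g\<in>carrier H. \<forall>w\<in>L. (Some \<circ> shift H g x) |` dom w \<noteq> w}"
  have "finite L"
    by (rule finite_subset[OF _ finite_set_of_finite_maps[OF \<open>finite D\<close>, of "e ` A"]])
      (use \<open>finite A\<close> in \<open>auto simp: L_def\<close>)
  then have "SFT H (e ` A) X"
    unfolding SFT_def by (intro exI[of _ L]) (use assms(3,4) in \<open>auto simp: L_def X_def\<close>)
  moreover have "X \<noteq> {}"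
  proof -
    define x where "x = (\<lambda>h\<in>carrier H. e (x0 h))"
    have "(Some \<circ> shift H g x) |` dom w \<noteq> w" if g: "g \<in> carrier H" and w: "w \<in> L" for g w
    proof
      assume eq: "(Some \<circ> shift H g x) |` dom w = w"
      have "dec (the (w d)) = x0 (inv\<^bsub>H\<^esub> g \<otimes>\<^bsub>H\<^esub> d)" if "d \<in> D" for d
      proof -
        have "d \<in> carrier H" "d \<in> dom w"
          using that w assms(4) by (auto simp: L_def)
        then have "w d = Some (e (x0 (inv\<^bsub>H\<^esub> g \<otimes>\<^bsub>H\<^esub> d)))"
          using g by (subst eq[symmetric]) (simp add: shift_def x_def)
        then show ?thesis
          using x0(1) g \<open>d \<in> carrier H\<close> by (auto intro!: dec)
      qed
      then have "(\<lambda>d\<in>D. dec (the (w d))) = (\<lambda>d\<in>D. x0 (inv\<^bsub>H\<^esub> g \<otimes>\<^bsub>H\<^esub> d))"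
        by (auto simp: restrict_def)
      then show False
        using w x0(2)[of "inv\<^bsub>H\<^esub> g"] g by (simp add: L_def)
    qed
    moreover have "x \<in> carrier H \<rightarrow>\<^sub>E e ` A"
      using x0(1) by (auto simp: x_def)
    ultimately show ?thesis
      unfolding X_def by blast
  qed
  moreover have "finite (Stab H x)" if x: "x \<in> X" for x
  proof -
    have xA: "x \<in> carrier H \<rightarrow>\<^sub>E e ` A"
      using x by (simp add: X_def)
    define y where "y = dec \<circ> x"
    have "y \<in> carrier H \<rightarrow> A"
      using PiE_mem[OF xA] dec' by (simp add: y_def)
    moreover have "P (\<lambda>d\<in>D. y (h \<otimes>\<^bsub>H\<^esub> d))" if h: "h \<in> carrier H" for h
    proof (rule ccontr)
      assume not: "\<not> P (\<lambda>d\<in>D. y (h \<otimes>\<^bsub>H\<^esub> d))"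
      \<comment> \<open>A violation at \<open>h\<close> is a forbidden pattern seen at the identity after shifting by \<open>inv h\<close>.\<close>
      define w where "w = (Some \<circ> shift H (inv\<^bsub>H\<^esub> h) x) |` D"
      have wD: "w d = Some (x (h \<otimes>\<^bsub>H\<^esub> d))" if "d \<in> D" for d
        using that assms(4) h by (auto simp: w_def shift_def)
      have dw: "dom w = D"
        by (auto simp: w_def restrict_map_def split: if_splits)
      have "ran w \<subseteq> e ` A"
      proof
        fix b assume "b \<in> ran w"
        then obtain d where "w d = Some b" "d \<in> D"
          using dw by (auto simp: ran_def)
        then have "b = x (h \<otimes>\<^bsub>H\<^esub> d)" "d \<in> carrier H" using wD assms(4) by auto
        then show "b \<in> e ` A" using xA h by auto
      qed
      moreover have "(\<lambda>d\<in>D. dec (the (w d))) = (\<lambda>d\<in>D. y (h \<otimes>\<^bsub>H\<^esub> d))"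
        by (auto simp: restrict_def wD y_def)
      ultimately have "w \<in> L"
        using dw not by (simp add: L_def)
      moreover have "(Some \<circ> shift H (inv\<^bsub>H\<^esub> h) x) |` dom w = w"
        unfolding dw by (simp add: w_def)
      ultimately show False
        using x h unfolding X_def by blast
    qed
    ultimately have "finite {g \<in> carrier H. \<forall>h\<in>carrier H. y (inv\<^bsub>H\<^esub> g \<otimes>\<^bsub>H\<^esub> h) = y h}"
      by (rule fin)
    moreover have "y (inv\<^bsub>H\<^esub> g \<otimes>\<^bsub>H\<^esub> h) = y h"
      if "g \<in> Stab H x" "h \<in> carrier H" for g h
    proof -
      have "shift H g x h = x h" using that by (simp add: Stab_def)
      then show ?thesis using that(2) by (simp add: y_def shift_def)
    qed
    then have "Stab H x \<subseteq> {g \<in> carrier H. \<forall>h\<in>carrier H. y (inv\<^bsub>H\<^esub> g \<otimes>\<^bsub>H\<^esub> h) = y h}"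
      by (auto simp: Stab_def)
    ultimately show ?thesis
      by (rule rev_finite_subset)
  qed
  ultimately show ?thesis
    unfolding admits_strongly_aperiodic_SFT_def strongly_aperiodic_def
    using \<open>finite A\<close> by blast
qed

section \<open>Averages along the integer direction\<close>

lemma bounded_scaled_multiples:
  fixes v :: "'a::real_normed_vector"
  assumes "bounded (range (\<lambda>n::nat. real n *\<^sub>R v))"
  shows "v = 0"
proof (rule ccontr)
  assume "v \<noteq> 0"
  obtain b where b: "\<And>n::nat. real n * norm v \<le> b"
    using assms by (auto simp: bounded_iff)
  obtain n :: nat where "real n > b / norm v"
    using reals_Archimedean2 by blast
  then show False
    using b[of n] \<open>v \<noteq> 0\<close> by (simp add: field_simps)
qed

text \<open>
  Shifting a bounded sequence by \<open>m\<close> changes only a bounded number of terms at both ends of a block.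
  The induction on \<open>m\<close> telescopes shifts by one.
\<close>

lemma bounded_shifted_block_sums:
  fixes f :: "int \<Rightarrow> 'a::real_normed_vector"
  assumes "bounded (range f)"
  shows "bounded (range (\<lambda>n::nat. \<Sum>i<n. f (int i + m) - f (int i)))"
proof (induction m rule: int_induct[where k = 0])
  case base
  then show ?case by (simp add: image_constant_conv)
next
  have tele: "(\<Sum>i<n. f (int i + (j + 1)) - f (int i + j)) = f (int n + j) - f j" for n j
    by (induction n) (auto simp: algebra_simps)
  have sub: "bounded (range (\<lambda>n::nat. f (g n)))" for g
    by (rule bounded_subset[OF assms]) auto
  have step: "bounded (range (\<lambda>n::nat. \<Sum>i<n. f (int i + (j + 1)) - f (int i + j)))" for j
    unfolding tele by (intro bounded_minus_comp sub)
  {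
    case (step1 m)
    show ?case
      using bounded_plus_comp[OF step[of m] step1(2)]
      by (simp add: sum.distrib[symmetric])
  next
    case (step2 m)
    show ?case
      using bounded_minus_comp[OF step2(2) step[of "m - 1"]]
      by (simp add: sum_subtractf[symmetric])
  }
qed

text \<open>
  The configurations of the subshift, without reference to an alphabet:
  \<open>u z h\<close> is the corner of the cube used on line \<open>h\<close>, \<open>a z h\<close> the integer matrix at position \<open>z\<close>, and
  \<open>c z h s\<close> the carry of a transducer that multiplies line \<open>h\<close> by \<open>s\<close> and writes the result on line
  \<open>h s\<inverse>\<close>. Summing the carry equation over a block telescopes, so a bounded carry
  does not affect averages.
\<close>

locale transducer_configuration = generated_matrix_group G S
  for G S :: "(real^'k^'k) set" +
  fixes U :: "(real^'k^'k) set"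
    and u a :: "int \<Rightarrow> real^'k^'k \<Rightarrow> real^'k^'k"
    and c :: "int \<Rightarrow> real^'k^'k \<Rightarrow> real^'k^'k \<Rightarrow> real^'k^'k"
  assumes cube_invertible: "\<And>v X. v \<in> U \<Longrightarrow> X \<in> {v..v+1} \<Longrightarrow> invertible X"
    and finite_U: "finite U"
    and u_mem: "\<And>z h. h \<in> G \<Longrightarrow> u z h \<in> U"
    and u_const: "\<And>z h. h \<in> G \<Longrightarrow> u (z + 1) h = u z h"
    and a_cube: "\<And>z h. h \<in> G \<Longrightarrow> a z h \<in> {u z h..u z h + 1}"
    and a_int: "\<And>z h i j. h \<in> G \<Longrightarrow> a z h $ i $ j \<in> \<int>"
    and carry: "\<And>z h s. h \<in> G \<Longrightarrow> s \<in> S \<Longrightarrow>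
      c (z + 1) h s = c z h s + (a z (h ** matrix_inv s) - s ** a z h)"
    and carry_bounded: "\<And>h s. h \<in> G \<Longrightarrow> s \<in> S \<Longrightarrow> bounded (range (\<lambda>z. c z h s))"
begin

definition block_sum :: "nat \<Rightarrow> real^'k^'k \<Rightarrow> real^'k^'k" where
  "block_sum n h = (\<Sum>i<n. a (int i) h)"

lemma a_cube0: "h \<in> G \<Longrightarrow> a z h \<in> {u 0 h..u 0 h + 1}"
proof -
  assume h: "h \<in> G"
  have "u z h = u 0 h"
  proof (induction z rule: int_induct[where k = 0])
    case (step2 i)
    then show ?case using u_const[OF h, of "i - 1"] by simp
  qed (use u_const[OF h] in simp_all)
  then show ?thesis using a_cube[OF h, of z] by simp
qed

lemma bounded_a: "h \<in> G \<Longrightarrow> bounded (range (\<lambda>z. a z h))"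
  by (rule bounded_subset[OF bounded_closed_interval[of "u 0 h" "u 0 h + 1"]]) (use a_cube0 in blast)

lemma average_cube:
  assumes "h \<in> G" "n > 0"
  shows "block_sum n h /\<^sub>R real n \<in> {u 0 h..u 0 h + 1}"
proof -
  have "(\<Sum>i<n. u 0 h) \<le> block_sum n h" "block_sum n h \<le> (\<Sum>i<n. u 0 h + 1)"
    unfolding block_sum_def by (rule sum_mono; use a_cube0[OF assms(1)] in simp)+
  then have "real n *\<^sub>R u 0 h /\<^sub>R real n \<le> block_sum n h /\<^sub>R real n"
    "block_sum n h /\<^sub>R real n \<le> real n *\<^sub>R (u 0 h + 1) /\<^sub>R real n"
    by (intro scaleR_left_mono; simp only: sum_constant_scaleR; simp)+
  then show ?thesis using assms(2) by simp
qed

text \<open>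
  For a generator, the difference is a difference of two carries. The general case follows
  by induction along a word in the generators, since multiplication by a fixed matrix preserves
  boundedness. Working up to bounded errors avoids having to know that averages converge.
\<close>

lemma block_sum_equivariant_up_to_bounded:
  assumes "g \<in> G" "h \<in> G"
  shows "bounded (range (\<lambda>n. block_sum n (h ** matrix_inv g) - g ** block_sum n h))"
proof -
  have gen: "bounded (range (\<lambda>n. block_sum n (h ** matrix_inv s) - s ** block_sum n h))"
    if "s \<in> S" "h \<in> G" for s h
  proof -
    have "block_sum n (h ** matrix_inv s) - s ** block_sum n h = c (int n) h s - c 0 h s" for n
    proof (induction n)
      case (Suc n)
      have "block_sum (Suc n) (h ** matrix_inv s) - s ** block_sum (Suc n) h
        = (block_sum n (h ** matrix_inv s) - s ** block_sum n h)
          + (a (int n) (h ** matrix_inv s) - s ** a (int n) h)"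
        by (simp add: block_sum_def matrix_add_ldistrib)
      moreover have "c (int (Suc n)) h s = c (int n) h s + (a (int n) (h ** matrix_inv s) - s ** a (int n) h)"
        using carry[OF that(2,1), of "int n"] by (simp add: add.commute)
      ultimately show ?case
        unfolding Suc by simp
    qed (simp add: block_sum_def matrix_mult_left_simps)
    moreover have "bounded (range (\<lambda>n. c (int n) h s))"
      by (rule bounded_subset[OF carry_bounded[OF that(2,1)]]) auto
    ultimately show ?thesis
      by (simp add: bounded_minus_comp)
  qed
  show ?thesis
    using assms
  proof (induction g arbitrary: h rule: generate_induct)
    case one
    then show ?case by (simp add: matrix_inv_one image_constant_conv)
  next
    case (gen s)
    then show ?case using \<open>\<And>s h. s \<in> S \<Longrightarrow> h \<in> G \<Longrightarrow> _\<close> by blast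
  next
    case (inv s)
    then have s: "s \<in> G" using S_subset by blast
    have "bounded ((\<lambda>B. matrix_inv s ** B) ` range (\<lambda>n. block_sum n (h ** s ** matrix_inv s)
        - s ** block_sum n (h ** s)))"
      by (intro bounded_linear_image[OF gen bounded_linear_matrix_mult_left] inv mult_mem s)
    then have "bounded (range (\<lambda>n. - (block_sum n (h ** s) - matrix_inv s ** block_sum n h)))"
      by (simp add: image_image matrix_mult_left_simps cancel s)
    then show ?case
      by (simp only: inv_inv[OF s] uminus_bounded_comp)
  next
    case (mult g1 g2)
    have "bounded ((\<lambda>B. g1 ** B) ` range (\<lambda>n. block_sum n (h ** matrix_inv g2) - g2 ** block_sum n h))"
      by (intro bounded_linear_image[OF mult(4) bounded_linear_matrix_mult_left] mult)
    moreover have "bounded (range (\<lambda>n. block_sum n (h ** matrix_inv g2 ** matrix_inv g1)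
        - g1 ** block_sum n (h ** matrix_inv g2)))"
      by (intro mult(3) mult_mem inv_mem mult)
    ultimately have "bounded (range (\<lambda>n. (block_sum n (h ** matrix_inv g2 ** matrix_inv g1)
        - g1 ** block_sum n (h ** matrix_inv g2))
        + g1 ** (block_sum n (h ** matrix_inv g2) - g2 ** block_sum n h)))"
      by (intro bounded_plus_comp) (simp_all add: image_image)
    then show ?case
      by (simp add: matrix_mult_left_simps inv_mult_distrib mult matrix_mul_assoc)
  qed
qed

text \<open>
  The blocks of the lines at \<open>mat 1\<close> and \<open>g\<inverse>\<close> differ by a bounded amount, because one line is
  a translate of the other, and also \<open>block_sum n (g\<inverse>)\<close> is \<open>g ** block_sum n (mat 1)\<close> up to a bounded amount. So
  the averages \<open>X\<close> of the line at \<open>mat 1\<close> satisfy \<open>g X - X \<longlonglongrightarrow> 0\<close>. They stay in a compact cube of invertible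
  matrices; a limit point \<open>t\<close> satisfies \<open>g t = t\<close> and can be cancelled.
\<close>

lemma period_group_component_trivial:
  assumes g: "g \<in> G" and per: "\<And>z h. h \<in> G \<Longrightarrow> a (z - m) (matrix_inv g ** h) = a z h"
  shows "g = mat 1"
proof -
  note 1 = one_mem
  let ?X = "\<lambda>n. block_sum (Suc n) (mat 1) /\<^sub>R real (Suc n)"
  have "a z (matrix_inv g) = a (z + m) (mat 1)" for z
    using per[OF 1, of "z + m"] by simp
  then have shifted: "bounded (range (\<lambda>n. block_sum n (matrix_inv g) - block_sum n (mat 1)))"
    using bounded_shifted_block_sums[OF bounded_a[OF 1], of m]
    by (simp add: block_sum_def sum_subtractf)
  have "bounded (range (\<lambda>n. (block_sum n (matrix_inv g) - block_sum n (mat 1))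
      - (block_sum n (mat 1 ** matrix_inv g) - g ** block_sum n (mat 1))))"
    by (rule bounded_minus_comp[OF shifted block_sum_equivariant_up_to_bounded[OF g 1]])
  then have "bounded (range (\<lambda>n. g ** block_sum n (mat 1) - block_sum n (mat 1)))"
    by simp
  then obtain b where b: "\<And>n. norm (g ** block_sum n (mat 1) - block_sum n (mat 1)) \<le> b"
    by (auto simp: bounded_iff)
  \<comment> \<open>\<open>Suc n\<close> in place of \<open>n\<close> avoids the empty block, whose average \<open>0\<close> is outside the cube.\<close>
  have lim0: "(\<lambda>n. g ** ?X n - ?X n) \<longlonglongrightarrow> 0"
  proof (rule Lim_null_comparison)
    show "\<forall>\<^sub>F n in sequentially. norm (g ** ?X n - ?X n) \<le> b / real (Suc n)"
    proof (intro always_eventually allI)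
      fix n
      have "g ** ?X n - ?X n = (g ** block_sum (Suc n) (mat 1) - block_sum (Suc n) (mat 1)) /\<^sub>R real (Suc n)"
        by (simp only: matrix_mult_left_simps scaleR_diff_right)
      then show "norm (g ** ?X n - ?X n) \<le> b / real (Suc n)"
        using divide_right_mono[OF b[of "Suc n"], of "real (Suc n)"]
        by (simp only: norm_scaleR norm_inverse abs_inverse divide_inverse_commute real_norm_def abs_of_nat)
    qed
    show "(\<lambda>n. b / real (Suc n)) \<longlonglongrightarrow> 0"
      by (rule LIMSEQ_Suc[OF lim_const_over_n])
  qed
  have "seq_compact {u 0 (mat 1)..u 0 (mat 1) + 1}"
    by (simp add: compact_imp_seq_compact)
  moreover have "\<forall>n. ?X n \<in> {u 0 (mat 1)..u 0 (mat 1) + 1}"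
    using average_cube[OF 1] by blast
  ultimately obtain t r where t: "t \<in> {u 0 (mat 1)..u 0 (mat 1) + 1}" and r: "strict_mono r"
    and lim: "(?X \<circ> r) \<longlonglongrightarrow> t"
    by (rule seq_compactE)
  have "((\<lambda>n. g ** (?X \<circ> r) n - (?X \<circ> r) n) \<longlonglongrightarrow> g ** t - t)"
    by (intro tendsto_diff bounded_linear.tendsto[OF bounded_linear_matrix_mult_left] lim)
  moreover have "((\<lambda>n. g ** (?X \<circ> r) n - (?X \<circ> r) n) \<longlonglongrightarrow> 0)"
    using LIMSEQ_subseq_LIMSEQ[OF lim0 r] by (simp add: o_def)
  ultimately have gt: "g ** t = t"
    using LIMSEQ_unique by fastforce
  have "invertible t"
    using cube_invertible[OF u_mem[OF 1]] t by blast
  then have "g = g ** t ** matrix_inv t"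
    by (simp add: matrix_mul_assoc[symmetric] matrix_inv_mult)
  also have "\<dots> = mat 1"
    using \<open>invertible t\<close> by (simp add: gt matrix_inv_mult)
  finally show ?thesis .
qed

text \<open>
  With period \<open>l\<close>, the block sums of length \<open>n l\<close> are \<open>n\<close> times those of length \<open>l\<close>. Equivariance up
  to a bounded error, multiplied by all \<open>n\<close>, must be exact: \<open>block_sum l (g\<inverse>) = g ** block_sum l (mat 1)\<close>. As
  \<open>block_sum l (mat 1)\<close> is invertible, distinct \<open>g\<close> have distinct sums; but these are integer matrices in
  a bounded set.
\<close>

lemma period_integer_component_trivial:
  assumes "infinite G" and per: "\<And>z h. h \<in> G \<Longrightarrow> a (z - m) h = a z h"
  shows "m = 0"
proof (rule ccontr)
  assume "m \<noteq> 0"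
  define l where "l = nat \<bar>m\<bar>"
  have l: "l > 0" using \<open>m \<noteq> 0\<close> by (simp add: l_def)
  have perl: "a (z + int l) h = a z h" if "h \<in> G" for z h
  proof (cases "m > 0")
    case True
    then have "z + int l - m = z" by (simp add: l_def)
    then show ?thesis using per[OF that, of "z + int l"] by metis
  next
    case False
    then have "z + int l = z - m" by (simp add: l_def)
    then show ?thesis using per[OF that, of z] by metis
  qed
  then have perl: "a (z + int (n * l)) h = a z h" if "h \<in> G" for z h n
  proof (induction n)
    case (Suc n)
    have "z + int (Suc n * l) = (z + int (n * l)) + int l"
      by simp
    then show ?case using Suc perl[OF that] by (simp only:)
  qed simp
  have split: "(\<Sum>i<p + q. f i) = (\<Sum>i<p. f i) + (\<Sum>i<q. f (p + i))"
    for p q and f :: "nat \<Rightarrow> real^'k^'k"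
    by (induction q) (auto simp: add.assoc)
  have block: "block_sum (n * l) h = real n *\<^sub>R block_sum l h" if "h \<in> G" for n h
  proof (induction n)
    case (Suc n)
    have "block_sum (Suc n * l) h = block_sum (n * l) h + (\<Sum>i<l. a (int (n * l + i)) h)"
      using split[of "\<lambda>i. a (int i) h" "n * l" l] by (simp add: block_sum_def add.commute[of l])
    also have "(\<Sum>i<l. a (int (n * l + i)) h) = block_sum l h"
      unfolding block_sum_def
    proof (rule sum.cong[OF refl])
      fix i
      have "int (n * l + i) = int i + int (n * l)" by simp
      then show "a (int (n * l + i)) h = a (int i) h"
        using perl[OF that] by (simp only:)
    qed
    finally show ?case
      by (simp only: Suc of_nat_Suc scaleR_left_distrib scaleR_one add.commute)
  qed (simp add: block_sum_def)
  have eq: "block_sum l (matrix_inv g) = g ** block_sum l (mat 1)" if g: "g \<in> G" for g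
  proof -
    have "bounded (range (\<lambda>n. block_sum n (matrix_inv g) - g ** block_sum n (mat 1)))"
      using block_sum_equivariant_up_to_bounded[OF g one_mem] by simp
    then have "bounded (range (\<lambda>n. block_sum (n * l) (matrix_inv g) - g ** block_sum (n * l) (mat 1)))"
      by (rule bounded_subset) auto
    then have "bounded (range (\<lambda>n. real n *\<^sub>R (block_sum l (matrix_inv g) - g ** block_sum l (mat 1))))"
      by (simp add: block g inv_mem one_mem matrix_mult_left_simps scaleR_diff_right)
    then show ?thesis
      using bounded_scaled_multiples by fastforce
  qed
  have inv: "invertible (block_sum l (mat 1))"
    using cube_invertible[OF u_mem[OF one_mem] average_cube[OF one_mem l]] l
    by (simp add: invertible_scaleR_iff)
  have "inj_on (\<lambda>g. block_sum l (matrix_inv g)) G"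
  proof (rule inj_onI)
    fix g g' assume g: "g \<in> G" "g' \<in> G" "block_sum l (matrix_inv g) = block_sum l (matrix_inv g')"
    then have "g ** block_sum l (mat 1) ** matrix_inv (block_sum l (mat 1))
      = g' ** block_sum l (mat 1) ** matrix_inv (block_sum l (mat 1))"
      by (simp add: eq)
    then show "g = g'"
      by (simp add: matrix_mul_assoc[symmetric] matrix_inv_mult inv)
  qed
  moreover have "finite ((\<lambda>g. block_sum l (matrix_inv g)) ` G)"
  proof -
    have "bounded (\<Union>v\<in>U. {v..v+1})"
      using finite_U by (intro bounded_UN) auto
    then obtain b where b: "\<And>v X. v \<in> U \<Longrightarrow> X \<in> {v..v+1} \<Longrightarrow> norm X \<le> b"
      unfolding bounded_iff by blast
    have "norm (block_sum l h) \<le> real l * b" if "h \<in> G" for h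
    proof -
      have "norm (block_sum l h) \<le> (\<Sum>i<l. b)"
        unfolding block_sum_def by (intro sum_norm_le b[OF u_mem a_cube] that)
      then show ?thesis by simp
    qed
    moreover have "1 * block_sum l h $ i $ j \<in> \<int>" if "h \<in> G" for h i j
      using a_int[OF that] by (simp add: block_sum_def Ints_sum)
    ultimately have "(\<lambda>g. block_sum l (matrix_inv g)) ` G
      \<subseteq> {M. (\<forall>i j. 1 * M $ i $ j \<in> \<int>) \<and> norm M \<le> real l * b}"
      using inv_mem by auto
    then show ?thesis
      by (rule finite_subset) (rule finite_integer_matrices, simp)
  qed
  ultimately show False
    using \<open>infinite G\<close> finite_imageD by blast
qed

end

section \<open>The subshift\<close>

text \<open>
  This is the carry of the transducer for \<open>A\<close> when it is fed with roundings of multiples of a real matrix.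
\<close>

definition rounding_defect :: "real^'m^'n \<Rightarrow> real^'p^'m \<Rightarrow> real^'p^'n" where
  "rounding_defect A Y = floor_matrix (A ** Y) - A ** floor_matrix Y"

text \<open>
  The defect is bounded because rounding moves each entry by less than one, and a common denominator
  of \<open>A\<close> is one for every defect.
\<close>

lemma finite_range_rounding_defect:
  fixes A :: "real^'m^'n"
  assumes "\<And>i j. A $ i $ j \<in> \<rat>"
  shows "finite (range (rounding_defect A :: real^'p^'m \<Rightarrow> _))"
proof -
  obtain d :: int where d: "d \<noteq> 0" "\<And>i j. of_int d * A $ i $ j \<in> \<int>"
    using rational_matrix_denominator[OF assms] by blast
  have frac: "bounded (range (\<lambda>Y :: real^'p^'q. Y - floor_matrix Y))"
    by (rule bounded_subset[OF bounded_closed_interval[of 0 1]])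
      (use floor_matrix_bounds in \<open>auto simp: algebra_simps\<close>)
  have "bounded ((\<lambda>B. A ** B) ` range (\<lambda>Y :: real^'p^'m. Y - floor_matrix Y))"
    by (rule bounded_linear_image[OF frac bounded_linear_matrix_mult_left])
  moreover have "bounded (range (\<lambda>Y :: real^'p^'m. A ** Y - floor_matrix (A ** Y)))"
    by (rule bounded_subset[OF frac]) auto
  ultimately have "bounded (range (\<lambda>Y :: real^'p^'m.
      A ** (Y - floor_matrix Y) - (A ** Y - floor_matrix (A ** Y))))"
    unfolding image_image by (rule bounded_minus_comp)
  then obtain r where r: "\<And>Y :: real^'p^'m. norm (rounding_defect A Y) \<le> r"
    by (auto simp: bounded_iff rounding_defect_def matrix_mult_left_simps)
  have "of_int d * rounding_defect A Y $ i $ j \<in> \<int>" for Y :: "real^'p^'m" and i j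
  proof -
    have "of_int d * (A ** floor_matrix Y) $ i $ j
      = (\<Sum>l\<in>UNIV. (of_int d * A $ i $ l) * floor_matrix Y $ l $ j)"
      by (simp add: matrix_matrix_mult_def sum_distrib_left mult.assoc)
    also have "\<dots> \<in> \<int>"
      by (intro Ints_sum Ints_mult d) (simp add: floor_matrix_def)
    finally have "of_int d * floor_matrix (A ** Y) $ i $ j - of_int d * (A ** floor_matrix Y) $ i $ j \<in> \<int>"
      by (rule Ints_diff[rotated]) (simp add: floor_matrix_def)
    then show ?thesis
      by (simp add: rounding_defect_def right_diff_distrib)
  qed
  then have "range (rounding_defect A :: real^'p^'m \<Rightarrow> _)
    \<subseteq> {M. (\<forall>i j. of_int d * M $ i $ j \<in> \<int>) \<and> norm M \<le> r}"
    using r by auto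
  then show ?thesis
    by (rule finite_subset) (rule finite_integer_matrices, use d(1) in simp)
qed

text \<open>
  A symbol consists of the corner of a cube, an integer matrix from this cube and, for every
  generator, a carry.
\<close>

type_synonym 'k symbol = "(real^'k^'k) \<times> (real^'k^'k) \<times> (real^'k^'k \<Rightarrow> real^'k^'k)"

context generated_matrix_group
begin

abbreviation "int_times_G \<equiv> integer_group \<times>\<times> GL\<lparr>carrier := G\<rparr>"

lemma group_int_times_G: "group int_times_G"
  by (intro DirProd_group group_integer_group group_G)

lemma int_times_G_simps:
  "carrier int_times_G = UNIV \<times> G"
  "(z, h) \<otimes>\<^bsub>int_times_G\<^esub> (z', h') = (z + z', h ** h')"
  "g \<in> G \<Longrightarrow> inv\<^bsub>int_times_G\<^esub> (z, g) = (- z, matrix_inv g)"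
  "A \<otimes>\<^bsub>GL\<^esub> B = A ** B"
  using inv_G by (simp_all add: group_G) (simp_all add: GL_def)

text \<open>
  The window sees a position, its right neighbour on the same line, and the same position on the lines that
  the generators write to.
\<close>

definition window :: "(int \<times> (real^'k^'k)) set" where
  "window = {(0, mat 1), (1, mat 1)} \<union> (\<lambda>s. (0, matrix_inv s)) ` S"

definition window_rule ::
    "(int \<times> (real^'k^'k) \<Rightarrow> 'k symbol) \<Rightarrow> bool" where
  "window_rule p \<longleftrightarrow>
     (let (u, a, c) = p (0, mat 1); (u', a', c') = p (1, mat 1)
      in u' = u \<and> (\<forall>s\<in>S. c' s = c s + (fst (snd (p (0, matrix_inv s))) - s ** a)))"

definition symbols ::
    "(real^'k^'k) set \<Rightarrow> 'k symbol set" where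
  "symbols U = (SIGMA u:U. {a \<in> {u..u+1}. \<forall>i j. a $ i $ j \<in> \<int>} \<times> (\<Pi>\<^sub>E s\<in>S. range (rounding_defect s)))"

lemma window_rule_restrict:
  assumes "h \<in> G"
  shows "window_rule (\<lambda>d\<in>window. x ((z, h) \<otimes>\<^bsub>int_times_G\<^esub> d)) \<longleftrightarrow>
    fst (x (z + 1, h)) = fst (x (z, h)) \<and>
    (\<forall>s\<in>S. snd (snd (x (z + 1, h))) s = snd (snd (x (z, h))) s
       + (fst (snd (x (z, h ** matrix_inv s))) - s ** fst (snd (x (z, h)))))"
  by (auto simp: window_rule_def window_def int_times_G_simps case_prod_beta)

text \<open>
  The configuration that shows the subshift to be nonempty puts on line \<open>h\<close> the differences of the
  roundings of consecutive multiples of \<open>N \<sqdot> h\<inverse>\<close>, so that this line has average \<open>N \<sqdot> h\<inverse>\<close>.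
\<close>

lemma admits_strongly_aperiodic_SFT_int_times_G:
  assumes inf: "infinite G"
    and rat: "\<And>s i j. s \<in> S \<Longrightarrow> s $ i $ j \<in> \<rat>"
    and U: "finite U"
      "\<And>g. g \<in> G \<Longrightarrow> floor_matrix (N *\<^sub>R g) \<in> U"
      "\<And>u X. u \<in> U \<Longrightarrow> X \<in> {u..u+1} \<Longrightarrow> invertible X"
  shows "admits_strongly_aperiodic_SFT int_times_G"
proof (rule admits_strongly_aperiodic_SFT_if_window_rule[where A = "symbols U" and D = window
      and P = window_rule])
  show "group int_times_G" by (rule group_int_times_G)
  show "finite (symbols U)"
    unfolding symbols_def
  proof (intro finite_SigmaI finite_cartesian_product finite_PiE finite_S U(1))
    fix u :: "real^'k^'k"
    obtain r where "\<And>X. X \<in> {u..u+1} \<Longrightarrow> norm X \<le> r"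
      using bounded_closed_interval[of u "u + 1"] unfolding bounded_iff by blast
    then have "{a \<in> {u..u+1}. \<forall>i j. a $ i $ j \<in> \<int>} \<subseteq> {M. (\<forall>i j. 1 * M $ i $ j \<in> \<int>) \<and> norm M \<le> r}"
      by auto
    then show "finite {a \<in> {u..u+1}. \<forall>i j. a $ i $ j \<in> \<int>}"
      by (rule finite_subset) (rule finite_integer_matrices, simp)
  qed (rule finite_range_rounding_defect, rule rat)
  show "finite window"
    using finite_S by (simp add: window_def)
  show "window \<subseteq> carrier int_times_G"
    using one_mem inv_mem S_subset by (auto simp: window_def int_times_G_simps)
next
  define y :: "int \<Rightarrow> real^'k^'k \<Rightarrow> real^'k^'k"
    where "y z h = real_of_int z *\<^sub>R N *\<^sub>R matrix_inv h" for z h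
  define a where "a z h = floor_matrix (y (z + 1) h) - floor_matrix (y z h)" for z h
  define x where "x = (\<lambda>(z, h). (floor_matrix (N *\<^sub>R matrix_inv h), a z h,
    \<lambda>s\<in>S. rounding_defect s (y z h)))"
  have a_cube: "a z h \<in> {floor_matrix (N *\<^sub>R matrix_inv h)..floor_matrix (N *\<^sub>R matrix_inv h) + 1}" for z h
  proof -
    have "\<lfloor>w\<rfloor> \<le> \<lfloor>v + w\<rfloor> - \<lfloor>v\<rfloor> \<and> \<lfloor>v + w\<rfloor> - \<lfloor>v\<rfloor> \<le> \<lfloor>w\<rfloor> + 1" for v w :: real
      by linarith
    then have fl: "of_int \<lfloor>w\<rfloor> \<le> of_int \<lfloor>v + w\<rfloor> - (of_int \<lfloor>v\<rfloor> :: real)"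
      "of_int \<lfloor>v + w\<rfloor> - of_int \<lfloor>v\<rfloor> \<le> (of_int \<lfloor>w\<rfloor> :: real) + 1" for v w :: real
      by (metis of_int_diff of_int_le_iff, metis of_int_1 of_int_add of_int_diff of_int_le_iff)
    show ?thesis
      by (auto simp: a_def y_def floor_matrix_def less_eq_vec_def scaleR_add_left distrib_right fl)
  qed
  have a_int: "a z h $ i $ j \<in> \<int>" for z h i j
    by (simp add: a_def floor_matrix_def)
  show "x \<in> carrier int_times_G \<rightarrow> symbols U"
    using a_cube a_int U(2) inv_mem by (auto simp: x_def symbols_def int_times_G_simps)
  show "window_rule (\<lambda>d\<in>window. x (h \<otimes>\<^bsub>int_times_G\<^esub> d))" if hl: "h \<in> carrier int_times_G" for h
  proof -
    obtain z g where h: "h = (z, g)" and g: "g \<in> G"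
      using hl by (cases h) (auto simp: int_times_G_simps)
    have "rounding_defect s (y (z + 1) g) = rounding_defect s (y z g) + (a z (g ** matrix_inv s) - s ** a z g)"
      if "s \<in> S" for s
    proof -
      have s: "s \<in> G" using that S_subset by blast
      \<comment> \<open>The carry equation reduces to the fact that line \<open>g s\<inverse>\<close> carries \<open>s\<close> times the values of line \<open>g\<close>.\<close>
      have "y w (g ** matrix_inv s) = s ** y w g" for w
        using s g by (simp add: y_def inv_mult_distrib inv_mem inv_inv matrix_mult_left_simps)
      then show ?thesis
        by (simp add: rounding_defect_def a_def matrix_mult_left_simps)
    qed
    then show ?thesis
      unfolding h window_rule_restrict[OF g] by (simp add: x_def)
  qed
next
  fix x
  assume x: "x \<in> carrier int_times_G \<rightarrow> symbols U"
    and rule: "\<And>h. h \<in> carrier int_times_G \<Longrightarrow> window_rule (\<lambda>d\<in>window. x (h \<otimes>\<^bsub>int_times_G\<^esub> d))"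
  define u where "u z h = fst (x (z, h))" for z h
  define a where "a z h = fst (snd (x (z, h)))" for z h
  define c where "c z h = snd (snd (x (z, h)))" for z h
  have sym: "u z h \<in> U" "a z h \<in> {u z h..u z h + 1}" "\<And>i j. a z h $ i $ j \<in> \<int>"
    "\<And>s. s \<in> S \<Longrightarrow> c z h s \<in> range (rounding_defect s)" if "h \<in> G" for z h
  proof -
    have "x (z, h) \<in> symbols U" using x that by (auto simp: int_times_G_simps)
    then show "u z h \<in> U" "a z h \<in> {u z h..u z h + 1}" "\<And>i j. a z h $ i $ j \<in> \<int>"
      "\<And>s. s \<in> S \<Longrightarrow> c z h s \<in> range (rounding_defect s)"
      by (auto simp: symbols_def u_def a_def c_def dest: PiE_mem)
  qed
  have step: "u (z + 1) h = u z h"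
    "\<And>s. s \<in> S \<Longrightarrow> c (z + 1) h s = c z h s + (a z (h ** matrix_inv s) - s ** a z h)"
    if "h \<in> G" for z h
    using rule[of "(z, h)"] that unfolding window_rule_restrict[OF that]
    by (auto simp: int_times_G_simps u_def a_def c_def)
  interpret transducer_configuration G S U u a c
  proof unfold_locales
    fix h s assume "h \<in> G" "s \<in> S"
    then show "bounded (range (\<lambda>z. c z h s))"
      using sym(4) by (intro bounded_subset[OF finite_imp_bounded[OF finite_range_rounding_defect[OF rat]]]) auto
  qed (use sym step U in auto)
  have "p = (0, mat 1)"
    if pl: "p \<in> carrier int_times_G" and per: "\<forall>h\<in>carrier int_times_G. x (inv\<^bsub>int_times_G\<^esub> p \<otimes>\<^bsub>int_times_G\<^esub> h) = x h" for p
  proof -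
    obtain m g where p: "p = (m, g)" and g: "g \<in> G"
      using pl by (cases p) (auto simp: int_times_G_simps)
    have a_per: "a (z - m) (matrix_inv g ** h) = a z h" if "h \<in> G" for z h
      using bspec[OF per, of "(z, h)"] that g by (simp add: int_times_G_simps p a_def)
    have g1: "g = mat 1"
      using period_group_component_trivial[OF g a_per] .
    then have "m = 0"
      using a_per by (intro period_integer_component_trivial[OF inf]) (simp add: matrix_inv_one)
    then show ?thesis using p g1 by simp
  qed
  then have "{g \<in> carrier int_times_G. \<forall>h\<in>carrier int_times_G. x (inv\<^bsub>int_times_G\<^esub> g \<otimes>\<^bsub>int_times_G\<^esub> h) = x h} \<subseteq> {(0, mat 1)}"
    by blast
  then show "finite {g \<in> carrier int_times_G. \<forall>h\<in>carrier int_times_G. x (inv\<^bsub>int_times_G\<^esub> g \<otimes>\<^bsub>int_times_G\<^esub> h) = x h}"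
    by (rule finite_subset) simp
qed

end

section \<open>Rational matrix groups contained in a compact group\<close>

theorem proposition5p12:
  fixes G K :: "(real^'k^'k) set"
  assumes "subgroup G GL"
    and "fin_gen (GL\<lparr>carrier := G\<rparr>)"
    and "\<forall>A\<in>G. \<forall>i j. A $ i $ j \<in> \<rat>"
    and "subgroup K GL" and "compact K" and "G \<subseteq> K"
  shows "PA'_recognizable (GL\<lparr>carrier := G\<rparr>) \<and>
         (infinite G \<longrightarrow>
            admits_strongly_aperiodic_SFT (integer_group \<times>\<times> (GL\<lparr>carrier := G\<rparr>)))"
proof -
  obtain S where "finite S" "S \<subseteq> G" "generate (GL\<lparr>carrier := G\<rparr>) S = G"
    using assms(2) by (auto simp: fin_gen_def)
  then interpret generated_matrix_group G S
    using assms(1)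
    by (simp add: generated_matrix_group_def generated_matrix_group_axioms_def matrix_group_def)
  have "invertible A" if "A \<in> K" for A
    using that subgroup.subset[OF assms(4)] by (auto simp: GL_def)
  then obtain N :: real and U where "finite U"
    and "\<And>A. A \<in> K \<Longrightarrow> floor_matrix (N *\<^sub>R A) \<in> U"
    and "\<And>u i j. u \<in> U \<Longrightarrow> u $ i $ j \<in> \<int>"
    and "\<And>u X. u \<in> U \<Longrightarrow> X \<in> {u..u+1} \<Longrightarrow> invertible X"
    using compact_invertible_cubes[OF assms(5)] by metis
  then show ?thesis
    using PA'_recognizable_G[of U N] admits_strongly_aperiodic_SFT_int_times_G[of U N] assms(3,6) S_subset
    by (auto simp: subset_iff)
qed

end
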